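(* Let $(\Omega_1,\Sigma_1,\mu)$ and $(\Omega_2,\Sigma_2,\nu)$ be $\sigma$-finite measure spaces, and let $f\in L_1(\mu\otimes\nu)$ be a real-valued function. Then the following assertions are equivalent: (i) $f\in\mathrm{NA}_\pi(L_1(\mu)\widehat{\otimes}_\pi L_1(\nu))$. (ii) $f=\sum_{i=1}^\infty c_i(\chi_{A_i}\otimes\chi_{B_i})-\sum_{j=1}^\infty d_j(\chi_{C_j}\otimes\chi_{D_j})$ for some $(c_i)_{i=1}^\infty,(d_j)_{j=1}^\infty\subseteq[0,\infty)$ and some measurable rectangles $A_i\times B_i$, $C_j\times D_j$ ($A_i,C_j\in\Sigma_1$, $B_i,D_j\in\Sigma_2$) satisfying $(\mu\otimes\nu)((A_i\times B_i)\cap(C_j\times D_j))=0$ whenever $c_id_j\neq0$. (iii) For each $c\geq0$, both of the sets $\{(\omega,\gamma): f(\omega,\gamma)>c\}$ and $\{(\omega,\gamma): f(\omega,\gamma)<-c\}$ coincide with a countable union of measurable rectangles, up to a $(\mu\otimes\nu)$-null set.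
   Context: The scalar field of the $L_1$ spaces is $\mathbb K\in\{\mathbb R,\mathbb C\}$. $\mu\otimes\nu$ is the product measure, and the projective tensor product $L_1(\mu)\widehat{\otimes}_\pi L_1(\nu)$ is isometrically identified with $L_1(\mu\otimes\nu)$ via $(g\otimes h)(\omega,\gamma)=g(\omega)h(\gamma)$ (so $\chi_A\otimes\chi_B=\chi_{A\times B}$). An element $u\in X\widehat{\otimes}_\pi Y$ attains its projective norm if there are $(x_i)\subseteq X$, $(y_i)\subseteq Y$ with $u=\sum_{i=1}^\infty x_i\otimes y_i$ and $\|u\|_\pi=\sum_{i=1}^\infty\|x_i\|\|y_i\|$; $\mathrm{NA}_\pi(X\widehat{\otimes}_\pi Y)$ is the set of such elements. A measurable rectangle is a set $A\times B$ with $A\in\Sigma_1$, $B\in\Sigma_2$. The two series in (ii) each converge in $L_1(\mu\otimes\nu)$. *)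

theory Defs
  imports "HOL-Analysis.Analysis"
begin

text \<open>
  Elements of \<open>L\<^sub>1(M)\<close> are represented by Bochner-integrable functions; two functions represent the
  same element iff they agree almost everywhere, i.e. iff their difference has \<open>L\<^sub>1\<close>-norm zero.
\<close>

definition L1_norm :: "'a measure \<Rightarrow> ('a \<Rightarrow> 'k::{banach,second_countable_topology}) \<Rightarrow> real"
  where "L1_norm M g = (LINT x|M. norm (g x))"

text \<open>
  Integrability of the terms and of the sum is demanded explicitly: the integral of a
  non-integrable function is \<open>0\<close> by convention, so the norm condition alone would not suffice.
  The sum is determined only up to null sets.
\<close>

definition L1_sums ::
    "'a measure \<Rightarrow> (nat \<Rightarrow> 'a \<Rightarrow> 'k::{banach,second_countable_topology}) \<Rightarrow> ('a \<Rightarrow> 'k) \<Rightarrow> bool"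
  where "L1_sums M u s \<longleftrightarrow>
    (\<forall>i. integrable M (u i)) \<and> integrable M s \<and>
    (\<lambda>n. L1_norm M (\<lambda>x. (\<Sum>i<n. u i x) - s x)) \<longlonglongrightarrow> 0"

definition fun_tensor :: "('a \<Rightarrow> 'k::times) \<Rightarrow> ('b \<Rightarrow> 'k) \<Rightarrow> 'a \<times> 'b \<Rightarrow> 'k"
  where "fun_tensor g h = (\<lambda>(x, y). g x * h y)"

text \<open>
  The projective tensor product of \<open>L\<^sub>1(M)\<close> and \<open>L\<^sub>1(N)\<close> is identified with the \<open>L\<^sub>1\<close>-space of the
  product measure via \<^const>\<open>fun_tensor\<close>.  Its elements are the sums of series
  \<open>\<Sum>i. g i \<otimes> h i\<close> with \<open>\<Sum>i. \<parallel>g i\<parallel> \<parallel>h i\<parallel> < \<infinity>\<close>, and the projective norm is the infimum of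
  \<open>\<Sum>i. \<parallel>g i\<parallel> \<parallel>h i\<parallel>\<close> over all such representations.  The scalar field is the type \<open>'k\<close>.
\<close>

definition proj_representation ::
    "'a measure \<Rightarrow> 'b measure \<Rightarrow>
     (nat \<Rightarrow> 'a \<Rightarrow> 'k::{real_normed_field,banach,second_countable_topology}) \<Rightarrow>
     (nat \<Rightarrow> 'b \<Rightarrow> 'k) \<Rightarrow> ('a \<times> 'b \<Rightarrow> 'k) \<Rightarrow> bool"
  where "proj_representation M N g h u \<longleftrightarrow>
    (\<forall>i. integrable M (g i)) \<and> (\<forall>i. integrable N (h i)) \<and>
    summable (\<lambda>i. L1_norm M (g i) * L1_norm N (h i)) \<and>
    L1_sums (M \<Otimes>\<^sub>M N) (\<lambda>i. fun_tensor (g i) (h i)) u"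

definition proj_norm ::
    "'a measure \<Rightarrow> 'b measure \<Rightarrow>
     ('a \<times> 'b \<Rightarrow> 'k::{real_normed_field,banach,second_countable_topology}) \<Rightarrow> real"
  where "proj_norm M N u =
    Inf {\<Sum>i. L1_norm M (g i) * L1_norm N (h i) | g h. proj_representation M N g h u}"

definition NA_proj ::
    "'a measure \<Rightarrow> 'b measure \<Rightarrow>
     ('a \<times> 'b \<Rightarrow> 'k::{real_normed_field,banach,second_countable_topology}) set"
  where "NA_proj M N = {u. \<exists>g h. proj_representation M N g h u \<and>
    proj_norm M N u = (\<Sum>i. L1_norm M (g i) * L1_norm N (h i))}"

definition rectangle_decomposable ::
    "'a measure \<Rightarrow> 'b measure \<Rightarrow> ('a \<times> 'b \<Rightarrow> real) \<Rightarrow> bool"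
  where "rectangle_decomposable M N f \<longleftrightarrow>
    (\<exists>(c :: nat \<Rightarrow> real) (d :: nat \<Rightarrow> real) A B C D p q.
      (\<forall>i. 0 \<le> c i) \<and> (\<forall>j. 0 \<le> d j) \<and>
      (\<forall>i. A i \<in> sets M \<and> B i \<in> sets N) \<and> (\<forall>j. C j \<in> sets M \<and> D j \<in> sets N) \<and>
      (\<forall>i j. c i * d j \<noteq> 0 \<longrightarrow>
        emeasure (M \<Otimes>\<^sub>M N) ((A i \<times> B i) \<inter> (C j \<times> D j)) = 0) \<and>
      L1_sums (M \<Otimes>\<^sub>M N) (\<lambda>i z. c i * fun_tensor (indicator (A i)) (indicator (B i)) z) p \<and>
      L1_sums (M \<Otimes>\<^sub>M N) (\<lambda>j z. d j * fun_tensor (indicator (C j)) (indicator (D j)) z) q \<and>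
      (AE z in M \<Otimes>\<^sub>M N. f z = p z - q z))"

definition ae_countable_rectangle_union ::
    "'a measure \<Rightarrow> 'b measure \<Rightarrow> ('a \<times> 'b) set \<Rightarrow> bool"
  where "ae_countable_rectangle_union M N S \<longleftrightarrow>
    (\<exists>\<R>. countable \<R> \<and> \<R> \<subseteq> {A \<times> B | A B. A \<in> sets M \<and> B \<in> sets N} \<and>
      sym_diff S (\<Union>\<R>) \<in> null_sets (M \<Otimes>\<^sub>M N))"

end

theory Submission
  imports Defs
begin

text \<open>
  Every series \<open>\<Sum>i. g i \<otimes> h i\<close> representing \<open>f\<close> satisfies \<open>\<parallel>f\<parallel> \<le> \<Sum>i. \<parallel>g i\<parallel> \<parallel>h i\<parallel>\<close>, and functions
  that are countable sums of disjoint weighted rectangles are represented with equality.  They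
  include a dense subspace of \<open>L\<^sub>1\<close>, whence the projective norm is the \<open>L\<^sub>1\<close>-norm and \<open>f\<close> attains
  it iff it has a representation with equality.  Equality forces the terms \<open>g i \<otimes> h i\<close> to have
  almost everywhere the sign of \<open>f\<close>, so that the positive part of \<open>f\<close> is the sum of the positive
  parts of the terms.  For \<open>c \<ge> 0\<close> the set where \<open>g \<otimes> h > c\<close> is the union over rational \<open>q > 0\<close> of the
  rectangles \<open>{g > q} \<times> {h > c / q}\<close> and \<open>{g < -q} \<times> {h < -c / q}\<close>, and a nonnegative function is almost
  everywhere a countable sum \<open>\<Sum>i. c i \<cdot> \<chi>(A i \<times> B i)\<close> with \<open>c i \<ge> 0\<close> iff its superlevel sets are, up
  to null sets, countable unions of rectangles.
\<close>

subsection \<open>Block functions and countable sums of rectangles\<close>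


text \<open>Sets that are countable unions of rectangles up to null sets are in general not closed
  under complements, and the positive part of a difference of two countable rectangle sums need not
  be one. Hence limits may only be reached monotonically, by suprema or by sums of nonnegative
  functions; subtraction is available at finite stages only. Block functions are made for these
  stages: they see each coordinate only through a label in \<open>nat\<close>, so they are stable
  under all pointwise operations, and a nonnegative one is a disjoint sum of rectangles.

  Positive parts are carried by \<open>ennreal\<close>, which maps negative reals to 0:
  \<open>ennreal (f z)\<close> and \<open>ennreal (- f z)\<close> are the two parts of
  \<open>f\<close>, and each of (i), (ii), (iii) is compared with \<open>rect_sum\<close> of both.

  Over the complex scalars attainment forces the terms of the series to be real, but not their
  factors; each term is therefore rewritten with real factors at no higher cost.\<close>

definition block_function ::
    "'a measure \<Rightarrow> 'b measure \<Rightarrow> ('a \<times> 'b \<Rightarrow> 'c) \<Rightarrow> bool"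
  where "block_function M N v \<longleftrightarrow>
    (\<exists>(a :: 'a \<Rightarrow> nat) (b :: 'b \<Rightarrow> nat) F.
      a \<in> measurable M (count_space UNIV) \<and> b \<in> measurable N (count_space UNIV) \<and>
      (\<forall>x\<in>space M. \<forall>y\<in>space N. v (x, y) = F (a x) (b y)))"

text \<open>Values in \<open>ennreal\<close> make the series meaningful without convergence
  conditions. Integrability and real convergence are recovered in \<open>rect_sum_expand\<close>,
  for integrable functions.\<close>

definition rect_sum :: "'a measure \<Rightarrow> 'b measure \<Rightarrow> ('a \<times> 'b \<Rightarrow> ennreal) \<Rightarrow> bool"
  where "rect_sum M N u \<longleftrightarrow>
    (\<exists>(c :: nat \<Rightarrow> real) A B. (\<forall>i. 0 \<le> c i) \<and> (\<forall>i. A i \<in> sets M \<and> B i \<in> sets N) \<and>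
      (AE z in M \<Otimes>\<^sub>M N. u z = (\<Sum>i. ennreal (c i) * indicator (A i \<times> B i) z)))"

definition rect_union :: "'a measure \<Rightarrow> 'b measure \<Rightarrow> ('a \<times> 'b \<Rightarrow> bool) \<Rightarrow> bool"
  where "rect_union M N P \<longleftrightarrow>
    (\<exists>A B. (\<forall>i::nat. A i \<in> sets M \<and> B i \<in> sets N) \<and>
      (AE z in M \<Otimes>\<^sub>M N. P z \<longleftrightarrow> (\<exists>i. z \<in> A i \<times> B i)))"

lemma block_function_const: "block_function M N (\<lambda>_. c)"
  unfolding block_function_def
  by (intro exI[of _ "\<lambda>_. 0"] exI[of _ "\<lambda>_ _. c"]) auto

lemma measurable_prod_encode:
  assumes a [measurable]: "a \<in> measurable M (count_space UNIV)"
    and b: "b \<in> measurable M (count_space UNIV)"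
  shows "(\<lambda>x. prod_encode (a x, b x)) \<in> measurable M (count_space UNIV)"
proof (rule measurable_compose_countable[OF _ a])
  show "(\<lambda>x. prod_encode (i, b x)) \<in> measurable M (count_space UNIV)" for i
    by (rule measurable_compose[OF b]) simp
qed

text \<open>Pairing the labels of \<open>v\<close> and \<open>w\<close> passes to a common
  refinement, on which both functions are determined. Labels are discrete, so \<open>op\<close> may
  be arbitrary; unary operations arise by ignoring one argument.\<close>

lemma block_function_comp2:
  assumes "block_function M N v" "block_function M N w"
  shows "block_function M N (\<lambda>z. op (v z) (w z))"
proof -
  from assms(1) obtain a :: "'a \<Rightarrow> nat" and b :: "'b \<Rightarrow> nat" and F where
    [measurable]: "a \<in> measurable M (count_space UNIV)" "b \<in> measurable N (count_space UNIV)"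
    and v: "\<And>x y. x \<in> space M \<Longrightarrow> y \<in> space N \<Longrightarrow> v (x, y) = F (a x) (b y)"
    unfolding block_function_def by metis
  from assms(2) obtain a' :: "'a \<Rightarrow> nat" and b' :: "'b \<Rightarrow> nat" and F' where
    [measurable]: "a' \<in> measurable M (count_space UNIV)" "b' \<in> measurable N (count_space UNIV)"
    and w: "\<And>x y. x \<in> space M \<Longrightarrow> y \<in> space N \<Longrightarrow> w (x, y) = F' (a' x) (b' y)"
    unfolding block_function_def by metis
  show ?thesis
    unfolding block_function_def
    by (intro exI[of _ "\<lambda>x. prod_encode (a x, a' x)"] exI[of _ "\<lambda>x. prod_encode (b x, b' x)"]
          exI[of _ "\<lambda>i j. op (F (fst (prod_decode i)) (fst (prod_decode j)))
                             (F' (snd (prod_decode i)) (snd (prod_decode j)))"] conjI measurable_prod_encode)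
      (simp_all add: v w)
qed

lemma block_function_rect:
  assumes [measurable]: "A \<in> sets M" "B \<in> sets N"
  shows "block_function M N (indicator (A \<times> B))"
  unfolding block_function_def
  by (intro exI[of _ "\<lambda>x. if x \<in> A then 1 else 0"] exI[of _ "\<lambda>y. if y \<in> B then 1 else 0"]
        exI[of _ "\<lambda>i j. if i = 1 \<and> j = 1 then 1 else 0"] conjI)
    (auto simp: indicator_def)

lemma block_function_sum:
  assumes "\<And>i. i < (n::nat) \<Longrightarrow> block_function M N (v i)"
  shows "block_function M N (\<lambda>z. \<Sum>i<n. v i z)"
  using assms by (induction n) (auto intro: block_function_const block_function_comp2)

text \<open>The products of a fibre of \<open>a\<close> and a fibre of \<open>b\<close>, numbered by
  \<open>prod_encode\<close>, partition the product space; \<open>k z\<close> is the number of the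
  cell that contains \<open>z\<close>. Cells may be empty.\<close>

lemma block_function_atoms:
  assumes "block_function M N v"
  obtains A B c and k :: "'a \<times> 'b \<Rightarrow> nat" where
    "\<And>i. A i \<in> sets M" "\<And>i. B i \<in> sets N"
    "\<And>z i. z \<in> space (M \<Otimes>\<^sub>M N) \<Longrightarrow> z \<in> A i \<times> B i \<longleftrightarrow> i = k z"
    "\<And>z. z \<in> space (M \<Otimes>\<^sub>M N) \<Longrightarrow> v z = c (k z)"
proof -
  from assms(1) obtain a :: "'a \<Rightarrow> nat" and b :: "'b \<Rightarrow> nat" and F where
    [measurable]: "a \<in> measurable M (count_space UNIV)" "b \<in> measurable N (count_space UNIV)"
    and v: "\<And>x y. x \<in> space M \<Longrightarrow> y \<in> space N \<Longrightarrow> v (x, y) = F (a x) (b y)"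
    unfolding block_function_def by metis
  show thesis
  proof (rule that[of "\<lambda>i. {x \<in> space M. a x = fst (prod_decode i)}"
        "\<lambda>i. {y \<in> space N. b y = snd (prod_decode i)}"
        "\<lambda>(x, y). prod_encode (a x, b y)" "\<lambda>i. F (fst (prod_decode i)) (snd (prod_decode i))"])
    fix z i assume "z \<in> space (M \<Otimes>\<^sub>M N)"
    then show "z \<in> {x \<in> space M. a x = fst (prod_decode i)} \<times> {y \<in> space N. b y = snd (prod_decode i)}
      \<longleftrightarrow> i = (case z of (x, y) \<Rightarrow> prod_encode (a x, b y))"
      by (cases z) (auto simp: space_pair_measure)
  qed (auto simp: v space_pair_measure)
qed

lemma block_function_rect_sum:
  assumes "block_function M N v" "\<And>z. z \<in> space (M \<Otimes>\<^sub>M N) \<Longrightarrow> 0 \<le> v z"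
  shows "rect_sum M N (\<lambda>z. ennreal (v z))"
proof -
  obtain A B c and k :: "'a \<times> 'b \<Rightarrow> nat" where A: "\<And>i. A i \<in> sets M" "\<And>i. B i \<in> sets N"
    and k: "\<And>z i. z \<in> space (M \<Otimes>\<^sub>M N) \<Longrightarrow> z \<in> A i \<times> B i \<longleftrightarrow> i = k z"
    and v: "\<And>z. z \<in> space (M \<Otimes>\<^sub>M N) \<Longrightarrow> v z = c (k z)"
    by (rule block_function_atoms[OF assms(1)], rule that)
  \<comment> \<open>Only the cell of \<open>z\<close> contributes. The value \<open>c i\<close>
    attached to an empty cell is not controlled by the sign of \<open>v\<close>, so
    \<open>max 0\<close> keeps the coefficients nonnegative.\<close>
  have "ennreal (v z) = (\<Sum>i. ennreal (max 0 (c i)) * indicator (A i \<times> B i) z)"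
    if z: "z \<in> space (M \<Otimes>\<^sub>M N)" for z
  proof -
    have "(\<Sum>i. ennreal (max 0 (c i)) * indicator (A i \<times> B i) z) =
      (\<Sum>i\<in>{k z}. ennreal (max 0 (c i)) * indicator (A i \<times> B i) z)"
      using k[OF z] by (intro suminf_finite) auto
    then show ?thesis using k[OF z] v[OF z] assms(2)[OF z] by (auto simp: max_def)
  qed
  then show ?thesis unfolding rect_sum_def using A
    by (intro exI[of _ "\<lambda>i. max 0 (c i)"] exI[of _ A] exI[of _ B]) auto
qed

text \<open>A predicate is a Boolean-valued block function, constant on each cell. The cells with
  value true are kept and the others are replaced by an empty rectangle.\<close>

lemma block_function_rect_union:
  assumes "block_function M N P"
  shows "rect_union M N P"
proof -
  obtain A B c and k :: "'a \<times> 'b \<Rightarrow> nat" where A: "\<And>i. A i \<in> sets M" "\<And>i. B i \<in> sets N"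
    and k: "\<And>z i. z \<in> space (M \<Otimes>\<^sub>M N) \<Longrightarrow> z \<in> A i \<times> B i \<longleftrightarrow> i = k z"
    and v: "\<And>z. z \<in> space (M \<Otimes>\<^sub>M N) \<Longrightarrow> P z = c (k z)"
    by (rule block_function_atoms[OF assms(1)], rule that)
  have "P z \<longleftrightarrow> (\<exists>i. z \<in> (if c i then A i else {}) \<times> B i)" if z: "z \<in> space (M \<Otimes>\<^sub>M N)" for z
  proof -
    have "z \<in> (if c i then A i else {}) \<times> B i \<longleftrightarrow> c i \<and> i = k z" for i
      using k[OF z, of i] by (cases "c i") auto
    then show ?thesis using v[OF z] by simp
  qed
  then have "AE z in M \<Otimes>\<^sub>M N. P z \<longleftrightarrow> (\<exists>i. z \<in> (if c i then A i else {}) \<times> B i)"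
    by (rule AE_I2)
  moreover have "(if c i then A i else {}) \<in> sets M \<and> B i \<in> sets N" for i using A by simp
  ultimately show ?thesis
    unfolding rect_union_def by (intro exI[of _ "\<lambda>i. if c i then A i else {}"] exI[of _ B]) simp
qed

lemma rect_union_countable:
  fixes P :: "nat \<Rightarrow> 'a \<times> 'b \<Rightarrow> bool"
  assumes "\<And>n. rect_union M N (P n)"
  shows "rect_union M N (\<lambda>z. \<exists>n. P n z)"
proof -
  have "\<forall>n. \<exists>A B. (\<forall>i::nat. A i \<in> sets M \<and> B i \<in> sets N) \<and>
      (AE z in M \<Otimes>\<^sub>M N. P n z \<longleftrightarrow> (\<exists>i. z \<in> A i \<times> B i))"
    using assms unfolding rect_union_def by blast
  then obtain A B where AB: "\<And>n i::nat. A n i \<in> sets M \<and> B n i \<in> sets N"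
    and P: "\<And>n. AE z in M \<Otimes>\<^sub>M N. P n z \<longleftrightarrow> (\<exists>i. z \<in> A n i \<times> B n i)"
    unfolding choice_iff by blast
  have "AE z in M \<Otimes>\<^sub>M N. \<forall>n. P n z \<longleftrightarrow> (\<exists>i. z \<in> A n i \<times> B n i)"
    using P by (simp add: AE_all_countable)
  then have "AE z in M \<Otimes>\<^sub>M N. (\<exists>n. P n z) \<longleftrightarrow>
      (\<exists>m. z \<in> case_prod A (prod_decode m) \<times> case_prod B (prod_decode m))"
  proof (rule AE_mp, intro AE_I2 impI)
    fix z assume *: "\<forall>n. P n z \<longleftrightarrow> (\<exists>i. z \<in> A n i \<times> B n i)"
    have "(\<exists>m. z \<in> case_prod A (prod_decode m) \<times> case_prod B (prod_decode m)) \<longleftrightarrow>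
       (\<exists>p. z \<in> case_prod A p \<times> case_prod B p)"
      by (metis prod_encode_inverse)
    then show "(\<exists>n. P n z) \<longleftrightarrow>
      (\<exists>m. z \<in> case_prod A (prod_decode m) \<times> case_prod B (prod_decode m))"
      using * by auto
  qed
  then show ?thesis unfolding rect_union_def using AB
    by (intro exI[of _ "\<lambda>m. case_prod A (prod_decode m)"] exI[of _ "\<lambda>m. case_prod B (prod_decode m)"])
      (auto split: prod.splits)
qed

lemma rect_union_cong:
  assumes "AE z in M \<Otimes>\<^sub>M N. P z \<longleftrightarrow> Q z"
  shows "rect_union M N P \<longleftrightarrow> rect_union M N Q"
proof -
  have "(AE z in M \<Otimes>\<^sub>M N. P z \<longleftrightarrow> R z) \<longleftrightarrow> (AE z in M \<Otimes>\<^sub>M N. Q z \<longleftrightarrow> R z)" for R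
    using assms by (intro iffI) auto
  then show ?thesis unfolding rect_union_def by simp
qed

lemma rect_sum_cong:
  assumes "AE z in M \<Otimes>\<^sub>M N. u z = w z"
  shows "rect_sum M N u \<longleftrightarrow> rect_sum M N w"
proof -
  have "(AE z in M \<Otimes>\<^sub>M N. u z = R z) \<longleftrightarrow> (AE z in M \<Otimes>\<^sub>M N. w z = R z)" for R
    using assms by (intro iffI) auto
  then show ?thesis unfolding rect_sum_def by simp
qed

lemma rect_sum_suminf:
  fixes u :: "nat \<Rightarrow> 'a \<times> 'b \<Rightarrow> ennreal"
  assumes "\<And>n. rect_sum M N (u n)"
  shows "rect_sum M N (\<lambda>z. \<Sum>n. u n z)"
proof -
  have "\<forall>n. \<exists>(c :: nat \<Rightarrow> real) A B. (\<forall>i. 0 \<le> c i) \<and> (\<forall>i. A i \<in> sets M \<and> B i \<in> sets N) \<and>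
      (AE z in M \<Otimes>\<^sub>M N. u n z = (\<Sum>i. ennreal (c i) * indicator (A i \<times> B i) z))"
    using assms unfolding rect_sum_def by blast
  then obtain c A B where AB: "\<And>n i::nat. A n i \<in> sets M \<and> B n i \<in> sets N"
    and c: "\<And>n i. 0 \<le> (c n i :: real)"
    and P: "\<And>n. AE z in M \<Otimes>\<^sub>M N. u n z = (\<Sum>i. ennreal (c n i) * indicator (A n i \<times> B n i) z)"
    unfolding choice_iff by blast
  have "AE z in M \<Otimes>\<^sub>M N. \<forall>n. u n z = (\<Sum>i. ennreal (c n i) * indicator (A n i \<times> B n i) z)"
    using P by (simp add: AE_all_countable)
  then have "AE z in M \<Otimes>\<^sub>M N. (\<Sum>n. u n z) = (\<Sum>m. ennreal (case_prod c (prod_decode m)) *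
      indicator (case_prod A (prod_decode m) \<times> case_prod B (prod_decode m)) z)"
  proof (rule AE_mp, intro AE_I2 impI)
    fix z assume *: "\<forall>n. u n z = (\<Sum>i. ennreal (c n i) * indicator (A n i \<times> B n i) z)"
    show "(\<Sum>n. u n z) = (\<Sum>m. ennreal (case_prod c (prod_decode m)) *
      indicator (case_prod A (prod_decode m) \<times> case_prod B (prod_decode m)) z)"
      using suminf_ennreal_2dimen[of "\<lambda>n. u n z" "\<lambda>(n, i). ennreal (c n i) * indicator (A n i \<times> B n i) z"] *
      by (simp add: split_beta comp_def)
  qed
  then show ?thesis unfolding rect_sum_def using AB c
    by (intro exI[of _ "\<lambda>m. case_prod c (prod_decode m)"] exI[of _ "\<lambda>m. case_prod A (prod_decode m)"]
        exI[of _ "\<lambda>m. case_prod B (prod_decode m)"])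
      (auto split: prod.splits)
qed


subsection \<open>Superlevel sets\<close>

lemma block_function_fst:
  assumes "Measurable.pred M p"
  shows "block_function M N (\<lambda>z. p (fst z))"
  unfolding block_function_def using assms
  by (intro exI[of _ "\<lambda>x. if p x then 1 else 0"] exI[of _ "\<lambda>_. 0"] exI[of _ "\<lambda>i _. i = 1"]) auto

lemma block_function_snd:
  assumes "Measurable.pred N p"
  shows "block_function M N (\<lambda>z. p (snd z))"
  unfolding block_function_def using assms
  by (intro exI[of _ "\<lambda>y. if p y then 1 else 0"] exI[of _ "\<lambda>_. 0"] exI[of _ "\<lambda>_ i. i = 1"]) auto

text \<open>In \<open>ennreal\<close> the sum is the supremum of its partial sums, so it exceeds
  \<open>t\<close> exactly when some partial sum does. Partial sums are block functions, and their
  superlevel sets are unions of cells.\<close>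

lemma rect_sum_superlevel:
  assumes "rect_sum M N u"
  shows "rect_union M N (\<lambda>z. t < u z)"
proof -
  obtain c A B where AB: "\<And>i::nat. A i \<in> sets M \<and> B i \<in> sets N"
    and u: "AE z in M \<Otimes>\<^sub>M N. u z = (\<Sum>i. ennreal (c i) * indicator (A i \<times> B i) z)"
    using assms unfolding rect_sum_def by blast
  have "block_function M N (\<lambda>z. \<Sum>i<n. ennreal (c i) * indicator (A i \<times> B i) z)" for n :: nat
    using AB by (intro block_function_sum block_function_comp2[of M N "\<lambda>_. ennreal _" "indicator _" "(*)"]
        block_function_const block_function_rect) auto
  from block_function_comp2[OF this block_function_const[of M N t], of "\<lambda>a b. b < a"]
  have "rect_union M N (\<lambda>z. \<exists>n. t < (\<Sum>i<n. ennreal (c i) * indicator (A i \<times> B i) z))"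
    by (intro rect_union_countable block_function_rect_union)
  also have "(\<lambda>z. \<exists>n. t < (\<Sum>i<n. ennreal (c i) * indicator (A i \<times> B i) z)) =
      (\<lambda>z. t < (\<Sum>i. ennreal (c i) * indicator (A i \<times> B i) z))"
    by (simp add: suminf_eq_SUP less_SUP_iff)
  finally show ?thesis
    by (subst rect_union_cong) (use u in \<open>auto elim!: eventually_mono\<close>)
qed

text \<open>
  Up to null sets, \<open>w\<close> is the supremum of countably many functions \<open>q \<cdot> \<chi>\<^bsub>R\<^esub>\<close> with \<open>q\<close> rational
  and \<open>R\<close> a rectangle.  The increments of the partial maxima are block functions, and these are
  disjoint sums of rectangles.
\<close>

lemma superlevel_rect_sum:
  fixes w :: "'a \<times> 'b \<Rightarrow> real"
  assumes "\<And>c. 0 \<le> c \<Longrightarrow> rect_union M N (\<lambda>z. c < w z)"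
  shows "rect_sum M N (\<lambda>z. ennreal (w z))"
proof -
  \<comment> \<open>Enumerates the nonnegative rational levels; the clamp at 0 reflects that the
    hypothesis speaks of levels \<open>c\<close> with \<open>0 \<le> c\<close>.\<close>
  define r where "r k = max 0 (real_of_rat (from_nat k))" for k :: nat
  have "\<forall>k. \<exists>A B. (\<forall>i::nat. A i \<in> sets M \<and> B i \<in> sets N) \<and>
      (AE z in M \<Otimes>\<^sub>M N. r k < w z \<longleftrightarrow> (\<exists>i. z \<in> A i \<times> B i))"
    using assms[unfolded rect_union_def, of "r _"] by (simp add: r_def del: max_less_iff_conj)
  then obtain A B where AB: "\<And>k i::nat. A k i \<in> sets M \<and> B k i \<in> sets N"
    and P: "\<And>k. AE z in M \<Otimes>\<^sub>M N. r k < w z \<longleftrightarrow> (\<exists>i. z \<in> A k i \<times> B k i)"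
    unfolding choice_iff by blast
  define R where "R m = (case prod_decode m of (k, i) \<Rightarrow> A k i \<times> B k i)" for m
  define q where "q m = r (fst (prod_decode m))" for m
  \<comment> \<open>Running maximum of 0 and the first \<open>n\<close> functions
    \<open>q m * indicator (R m) z\<close>. Starting at 0 lets the increments telescope to
    \<open>s n z\<close> without a remainder.\<close>
  define s where "s n z = rec_nat (0::real) (\<lambda>m t. max t (q m * indicator (R m) z)) n" for n z
  have s_0: "s 0 z = 0" and s_Suc: "s (Suc m) z = max (s m z) (q m * indicator (R m) z)" for m z
    by (simp_all add: s_def)
  have bs: "block_function M N (s n)" for n
  proof (induction n)
    case 0
    show ?case using block_function_const[of M N 0] by (simp add: s_0[abs_def])
  next
    case (Suc m)
    have "block_function M N (indicator (R m) :: _ \<Rightarrow> real)"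
      unfolding R_def using AB by (auto split: prod.split intro!: block_function_rect)
    then have "block_function M N (\<lambda>z. max (s m z) (q m * indicator (R m) z))"
      using block_function_comp2[OF Suc, of _ "\<lambda>a b. max a (q m * b)"] by simp
    then show ?case by (simp add: s_Suc[abs_def])
  qed
  have mono: "s m z \<le> s (Suc m) z" for m z by (simp add: s_Suc)
  have nonneg: "0 \<le> s m z" for m z by (induction m) (auto simp: s_0 s_Suc)
  have "rect_sum M N (\<lambda>z. \<Sum>m. ennreal (s (Suc m) z - s m z))"
    using mono by (intro rect_sum_suminf block_function_rect_sum block_function_comp2[OF bs bs]) auto
  moreover have "AE z in M \<Otimes>\<^sub>M N. ennreal (w z) = (\<Sum>m. ennreal (s (Suc m) z - s m z))"
  proof -
    have "AE z in M \<Otimes>\<^sub>M N. \<forall>k. r k < w z \<longleftrightarrow> (\<exists>i. z \<in> A k i \<times> B k i)"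
      using P by (simp add: AE_all_countable)
    then show ?thesis
    proof (rule AE_mp, intro AE_I2 impI)
      fix z assume z: "\<forall>k. r k < w z \<longleftrightarrow> (\<exists>i. z \<in> A k i \<times> B k i)"
      have sum: "(\<Sum>m<n. ennreal (s (Suc m) z - s m z)) = ennreal (s n z)" for n
        using mono sum_lessThan_telescope[of "\<lambda>n. s n z" n] by (subst sum_ennreal) (auto simp: s_0)
      have "q m < w z" if "z \<in> R m" for m
        using that z unfolding R_def q_def by (auto split: prod.splits)
      then have "q m * indicator (R m) z \<le> max 0 (w z)" for m
        by (auto simp: indicator_def intro: less_imp_le max.coboundedI2)
      then have le: "s n z \<le> max 0 (w z)" for n
        by (induction n) (auto simp: s_0 s_Suc)
      have "(SUP n. ennreal (s n z)) = ennreal (w z)"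
      proof (rule antisym)
        show "(SUP n. ennreal (s n z)) \<le> ennreal (w z)"
          using le[THEN ennreal_leI] by (intro SUP_least) (simp add: ennreal_max_0 max.commute)
        show "ennreal (w z) \<le> (SUP n. ennreal (s n z))"
        proof (rule ccontr)
          \<comment> \<open>If the supremum were some \<open>t\<close> below \<open>w z\<close>, a
            rational \<open>p\<close> strictly between them would be a level whose superlevel set
            contains \<open>z\<close>. One of the rectangles of that level then contains
            \<open>z\<close>, and the maximum taken after it is at least \<open>p\<close>.\<close>
          assume "\<not> ?thesis"
          then have less: "(SUP n. ennreal (s n z)) < ennreal (w z)" by simp
          then obtain t where t: "0 \<le> t" "(SUP n. ennreal (s n z)) = ennreal t"
            by (metis ennreal_cases ennreal_less_top less_irrefl less_trans)
          with less have "t < w z" by (simp add: ennreal_less_iff)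
          then obtain p where p: "t < real_of_rat p" "real_of_rat p < w z"
            using of_rat_dense by blast
          have r: "r (to_nat p) = real_of_rat p" using p t by (simp add: r_def)
          then obtain i where i: "z \<in> A (to_nat p) i \<times> B (to_nat p) i" using z p by metis
          define m where "m = prod_encode (to_nat p, i)"
          have "real_of_rat p \<le> s (Suc m) z"
            using i r by (simp add: s_Suc m_def q_def R_def)
          also have "ennreal (s (Suc m) z) \<le> ennreal t"
            unfolding t(2)[symmetric] by (rule SUP_upper) simp
          then have "s (Suc m) z \<le> t" using t by (simp add: ennreal_le_iff)
          finally show False using p by simp
        qed
      qed
      then show "ennreal (w z) = (\<Sum>m. ennreal (s (Suc m) z - s m z))"
        by (simp add: suminf_eq_SUP sum)
    qed
  qed
  ultimately show ?thesis by (subst rect_sum_cong)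
qed

text \<open>From \<open>c < a * b\<close> both factors are positive, and any rational strictly
  between \<open>c / b\<close> and \<open>a\<close> serves as \<open>q\<close>. The right-hand side
  separates \<open>a\<close> from \<open>b\<close>, so for each \<open>q\<close> it becomes a
  product condition.\<close>

lemma mult_greater_iff_rat:
  fixes a b c :: real
  assumes "0 \<le> c" "0 \<le> a"
  shows "c < a * b \<longleftrightarrow> (\<exists>q. 0 < q \<and> real_of_rat q < a \<and> c < real_of_rat q * b)"
proof
  assume *: "c < a * b"
  then have "0 < a * b" using assms by linarith
  then have "0 < a" "0 < b" using assms by (auto simp: zero_less_mult_iff)
  then have "c / b < a" using * by (simp add: pos_divide_less_eq)
  then obtain q where q: "c / b < real_of_rat q" "real_of_rat q < a" using of_rat_dense by blast
  moreover have "0 \<le> c / b" using assms \<open>0 < b\<close> by simp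
  ultimately have "0 < real_of_rat q" by linarith
  then show "\<exists>q. 0 < q \<and> real_of_rat q < a \<and> c < real_of_rat q * b"
    using q \<open>0 < b\<close> \<open>0 < real_of_rat q\<close> pos_divide_less_eq[of b c "real_of_rat q"]
    by (intro exI[of _ q]) simp
next
  assume "\<exists>q. 0 < q \<and> real_of_rat q < a \<and> c < real_of_rat q * b"
  then obtain q where q: "0 < real_of_rat q" "real_of_rat q < a" "c < real_of_rat q * b" by auto
  then have "0 < real_of_rat q * b" using assms by linarith
  then have "0 < b" using q by (simp add: zero_less_mult_iff)
  then show "c < a * b" using q by (meson less_trans mult_strict_right_mono)
qed

text \<open>A product above \<open>c \<ge> 0\<close> has factors of equal sign; the second instance
  of \<open>?Q\<close>, for the negated functions, covers two negative factors. For a fixed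
  rational, \<open>?Q\<close> is a conjunction of conditions on single coordinates, hence a block
  function.\<close>

lemma rect_union_fun_tensor:
  fixes g :: "'a \<Rightarrow> real" and h :: "'b \<Rightarrow> real"
  assumes [measurable]: "g \<in> borel_measurable M" "h \<in> borel_measurable N" and c: "0 \<le> c"
  shows "rect_union M N (\<lambda>z. c < fun_tensor g h z)"
proof -
  let ?Q = "\<lambda>g h n z. 0 < (from_nat n :: rat) \<and> real_of_rat (from_nat n) < g (fst z) \<and>
    c < real_of_rat (from_nat n) * h (snd z)"
  have Q: "rect_union M N (\<lambda>z. \<exists>n. ?Q g h n z \<or> ?Q (\<lambda>x. - g x) (\<lambda>y. - h y) n z)"
  proof (intro rect_union_countable block_function_rect_union)
    fix n
    have *: "block_function M N (?Q g h n)"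
      if [measurable]: "g \<in> borel_measurable M" "h \<in> borel_measurable N" for g h
      by (intro block_function_comp2[of M N _ _ "(\<and>)"] block_function_const
          block_function_fst[where p="\<lambda>x. real_of_rat (from_nat n) < g x"]
          block_function_snd[where p="\<lambda>y. c < real_of_rat (from_nat n) * h y"]) measurable
    show "block_function M N (\<lambda>z. ?Q g h n z \<or> ?Q (\<lambda>x. - g x) (\<lambda>y. - h y) n z)"
      by (intro block_function_comp2[of M N _ _ "(\<or>)"] *) measurable
  qed
  let ?P = "\<lambda>a b q. 0 < q \<and> real_of_rat q < a \<and> c < real_of_rat q * b"
  have "c < a * b \<longleftrightarrow> (\<exists>n. ?P a b (from_nat n) \<or> ?P (- a) (- b) (from_nat n))" for a b :: real
  proof -
    have ex: "(\<exists>n. R (from_nat n :: rat)) \<longleftrightarrow> (\<exists>q. R q)" for R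
      by (metis from_nat_to_nat)
    \<comment> \<open>Whatever the sign of \<open>a\<close>, one of the two disjuncts is impossible,
      and the other has a nonnegative first factor, as \<open>mult_greater_iff_rat\<close>
      asks.\<close>
    have P: "\<not> ?P a b q" if "a \<le> 0" for a b :: real and q
      using that by (smt (verit) zero_less_of_rat_iff)
    have pos: "c < a * b \<longleftrightarrow> (\<exists>q. ?P a b q)" if "0 \<le> a" for a b
      using mult_greater_iff_rat[OF c that] by simp
    have "c < a * b \<longleftrightarrow> (\<exists>q. ?P a b q \<or> ?P (- a) (- b) q)"
    proof (cases "0 \<le> a")
      case True
      then have "\<not> ?P (- a) (- b) q" for q by (intro P) simp
      then show ?thesis using pos[OF True, of b] by blast
    next
      case False
      then have "\<not> ?P a b q" for q by (intro P) simp
      moreover have "c < a * b \<longleftrightarrow> (\<exists>q. ?P (- a) (- b) q)"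
        using pos[of "- a" "- b"] False by (simp del: mult_minus_right)
      ultimately show ?thesis by blast
    qed
    also have "\<dots> \<longleftrightarrow> (\<exists>n. ?P a b (from_nat n) \<or> ?P (- a) (- b) (from_nat n))"
      by (rule ex[of "\<lambda>q. ?P a b q \<or> ?P (- a) (- b) q", symmetric])
    finally show ?thesis .
  qed
  then have "(\<lambda>z. c < fun_tensor g h z) = (\<lambda>z. \<exists>n. ?Q g h n z \<or> ?Q (\<lambda>x. - g x) (\<lambda>y. - h y) n z)"
    unfolding fun_tensor_def split_beta by (intro ext)
  then show ?thesis using Q by simp
qed


subsection \<open>Rectangle decompositions\<close>

lemma AE_summable_norm:
  fixes u :: "nat \<Rightarrow> 'a \<Rightarrow> 'k::{banach,second_countable_topology}"
  assumes u: "\<And>i. integrable M (u i)" and s: "summable (\<lambda>i. L1_norm M (u i))"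
  shows "AE x in M. summable (\<lambda>i. norm (u i x))"
proof -
  have [measurable]: "u i \<in> borel_measurable M" for i using u by auto
  have "(\<integral>\<^sup>+x. (\<Sum>i. ennreal (norm (u i x))) \<partial>M) = (\<Sum>i. \<integral>\<^sup>+x. ennreal (norm (u i x)) \<partial>M)"
    by (rule nn_integral_suminf) measurable
  also have "\<dots> = (\<Sum>i. ennreal (L1_norm M (u i)))"
    unfolding L1_norm_def using u by (intro suminf_cong nn_integral_eq_integral) auto
  also have "\<dots> \<noteq> \<infinity>"
    using s by (subst suminf_ennreal2) (auto simp: L1_norm_def)
  finally have "AE x in M. (\<Sum>i. ennreal (norm (u i x))) \<noteq> \<infinity>"
    by (intro nn_integral_PInf_AE) measurable
  then show ?thesis
    by eventually_elim (auto intro: summable_suminf_not_top)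
qed

lemma integrable_sum_norm:
  fixes u :: "nat \<Rightarrow> 'a \<Rightarrow> 'k::{banach,second_countable_topology}"
  assumes u: "\<And>i. integrable M (u i)" and s: "summable (\<lambda>i. L1_norm M (u i))"
  shows "integrable M (\<lambda>x. \<Sum>i. norm (u i x))"
    and "(LINT x|M. (\<Sum>i. norm (u i x))) = (\<Sum>i. L1_norm M (u i))"
  unfolding L1_norm_def using AE_summable_norm[OF assms] s u
  by (auto intro!: integrable_suminf integral_suminf simp: L1_norm_def)

text \<open>Dominated convergence, with bound \<open>(\<Sum>i. norm (u i x)) + norm (g x)\<close>,
  turns convergence almost everywhere into convergence in mean. Conversely the series has a sum
  \<open>g\<close> almost everywhere, which by the first part is also its limit in mean, so
  \<open>f\<close> and \<open>g\<close> agree almost everywhere.\<close>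

lemma L1_sums_iff:
  fixes u :: "nat \<Rightarrow> 'a \<Rightarrow> 'k::{banach,second_countable_topology}"
  assumes u: "\<And>i. integrable M (u i)" and s: "summable (\<lambda>i. L1_norm M (u i))"
    and f: "integrable M f"
  shows "L1_sums M u f \<longleftrightarrow> (AE x in M. (\<lambda>i. u i x) sums f x)"
proof -
  have [measurable]: "u i \<in> borel_measurable M" for i using u by auto
  have lim: "(\<lambda>n. L1_norm M (\<lambda>x. (\<Sum>i<n. u i x) - g x)) \<longlonglongrightarrow> 0"
    if g: "integrable M g" "AE x in M. (\<lambda>i. u i x) sums g x" for g
  proof -
    have [measurable]: "g \<in> borel_measurable M" using g by auto
    have "(\<lambda>n. LINT x|M. norm ((\<Sum>i<n. u i x) - g x)) \<longlonglongrightarrow> (LINT x|M. 0)"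
    proof (rule integral_dominated_convergence)
      show "integrable M (\<lambda>x. (\<Sum>i. norm (u i x)) + norm (g x))"
        using integrable_sum_norm(1)[OF u s] g by auto
      show "AE x in M. (\<lambda>n. norm ((\<Sum>i<n. u i x) - g x)) \<longlonglongrightarrow> 0"
        using g(2) by eventually_elim (simp add: sums_def LIM_zero tendsto_norm_zero)
      show "AE x in M. norm (norm ((\<Sum>i<n. u i x) - g x)) \<le> (\<Sum>i. norm (u i x)) + norm (g x)" for n
        using AE_summable_norm[OF u s]
      proof eventually_elim
        case (elim x)
        have "norm ((\<Sum>i<n. u i x) - g x) \<le> norm (\<Sum>i<n. u i x) + norm (g x)"
          by (rule norm_triangle_ineq4)
        also have "norm (\<Sum>i<n. u i x) \<le> (\<Sum>i<n. norm (u i x))" by (rule norm_sum)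
        also have "\<dots> \<le> (\<Sum>i. norm (u i x))" using elim by (intro sum_le_suminf) auto
        finally show ?case by simp
      qed
    qed auto
    then show ?thesis by (simp add: L1_norm_def)
  qed
  show ?thesis
  proof
    assume "AE x in M. (\<lambda>i. u i x) sums f x"
    then show "L1_sums M u f" using lim f u by (simp add: L1_sums_def)
  next
    assume L: "L1_sums M u f"
    define g where "g x = (\<Sum>i. u i x)" for x
    have "AE x in M. (\<lambda>i. u i x) sums g x"
      using AE_summable_norm[OF u s] unfolding g_def
      by eventually_elim (auto intro: summable_sums summable_norm_cancel)
    moreover have g: "integrable M g"
      unfolding g_def using AE_summable_norm[OF u s] s
      by (intro integrable_suminf u) (simp_all add: L1_norm_def)
    ultimately have 2: "(\<lambda>n. L1_norm M (\<lambda>x. (\<Sum>i<n. u i x) - g x)) \<longlonglongrightarrow> 0"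
      by (intro lim)
    have 1: "(\<lambda>n. L1_norm M (\<lambda>x. (\<Sum>i<n. u i x) - f x)) \<longlonglongrightarrow> 0"
      using L by (simp add: L1_sums_def)
    have "L1_norm M (\<lambda>x. f x - g x) \<le>
        L1_norm M (\<lambda>x. (\<Sum>i<n. u i x) - f x) + L1_norm M (\<lambda>x. (\<Sum>i<n. u i x) - g x)" for n
      unfolding L1_norm_def
    proof (subst Bochner_Integration.integral_add[symmetric])
      show "(LINT x|M. norm (f x - g x)) \<le>
        (LINT x|M. norm ((\<Sum>i<n. u i x) - f x) + norm ((\<Sum>i<n. u i x) - g x))"
      proof (rule integral_mono)
        show "norm (f x - g x) \<le> norm ((\<Sum>i<n. u i x) - f x) + norm ((\<Sum>i<n. u i x) - g x)" for x
          using norm_triangle_ineq4[of "(\<Sum>i<n. u i x) - g x" "(\<Sum>i<n. u i x) - f x"] by simp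
      qed (use u f g in auto)
    qed (use u f g in auto)
    then have "L1_norm M (\<lambda>x. f x - g x) \<le> 0"
      using tendsto_add[OF 1 2] by (intro tendsto_lowerbound[OF tendsto_add[OF 1 2, simplified]]) auto
    moreover have "0 \<le> L1_norm M (\<lambda>x. f x - g x)" by (simp add: L1_norm_def)
    ultimately have "(LINT x|M. norm (f x - g x)) = 0"
      unfolding L1_norm_def by (rule antisym)
    then have "AE x in M. f x = g x"
      using f g by (subst (asm) integral_nonneg_eq_0_iff_AE) auto
    with \<open>AE x in M. (\<lambda>i. u i x) sums g x\<close> show "AE x in M. (\<lambda>i. u i x) sums f x"
      by eventually_elim simp
  qed
qed

text \<open>Without cancellation the norm of a partial sum is the sum of the norms, and the partial
  sums of a convergent series are bounded. This supplies the absolute summability required by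
  \<open>L1_sums_iff\<close> from the mere convergence demanded in (ii).\<close>

lemma summable_L1_norm_nonneg:
  fixes u :: "nat \<Rightarrow> 'a \<Rightarrow> real"
  assumes L: "L1_sums M u f" and nonneg: "\<And>i x. 0 \<le> u i x"
  shows "summable (\<lambda>i. L1_norm M (u i))"
proof -
  have u: "integrable M (u i)" and f: "integrable M f" for i using L by (auto simp: L1_sums_def)
  have "convergent (\<lambda>n. L1_norm M (\<lambda>x. (\<Sum>i<n. u i x) - f x))"
    using L unfolding L1_sums_def by (intro convergentI) blast
  then obtain K where "\<forall>n. norm (L1_norm M (\<lambda>x. (\<Sum>i<n. u i x) - f x)) \<le> K"
    using convergent_imp_Bseq BseqE by blast
  then have K: "L1_norm M (\<lambda>x. (\<Sum>i<n. u i x) - f x) \<le> K" for n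
    by (metis abs_le_D1 real_norm_def)
  have "(\<Sum>i<n. L1_norm M (u i)) \<le> K + L1_norm M f" for n
  proof -
    have "(\<Sum>i<n. L1_norm M (u i)) = (LINT x|M. (\<Sum>i<n. u i x))"
      using u nonneg by (simp add: L1_norm_def)
    also have "\<dots> \<le> (LINT x|M. norm ((\<Sum>i<n. u i x) - f x) + norm (f x))"
      using u f by (intro integral_mono) auto
    also have "\<dots> = L1_norm M (\<lambda>x. (\<Sum>i<n. u i x) - f x) + L1_norm M f"
      unfolding L1_norm_def using u f by (intro Bochner_Integration.integral_add) auto
    finally show ?thesis using K[of n] by simp
  qed
  then show ?thesis
    by (intro summableI_nonneg_bounded) (auto simp: L1_norm_def)
qed

text \<open>Monotone convergence transfers the \<open>ennreal\<close> identity to the reals. Each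
  term is dominated by the total, hence integrable; the total is \<open>max 0 (f z)\<close> because
  \<open>ennreal\<close> cuts off negative values; and norms of nonnegative terms add up
  exactly.\<close>

lemma rect_sum_expand:
  assumes "rect_sum M N (\<lambda>z. ennreal (f z))" and f: "integrable (M \<Otimes>\<^sub>M N) f"
  obtains c :: "nat \<Rightarrow> real" and A B where
    "\<And>i. 0 \<le> c i" "\<And>i. A i \<in> sets M" "\<And>i. B i \<in> sets N"
    "\<And>i. integrable (M \<Otimes>\<^sub>M N) (\<lambda>z. c i * indicator (A i \<times> B i) z)"
    "AE z in M \<Otimes>\<^sub>M N. (\<lambda>i. c i * indicator (A i \<times> B i) z) sums max 0 (f z)"
    "(\<lambda>i. L1_norm (M \<Otimes>\<^sub>M N) (\<lambda>z. c i * indicator (A i \<times> B i) z)) sums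
      (LINT z|(M \<Otimes>\<^sub>M N). max 0 (f z))"
proof -
  let ?P = "M \<Otimes>\<^sub>M N"
  obtain c A B where c: "\<And>i::nat. 0 \<le> c i" and AB: "\<And>i. A i \<in> sets M \<and> B i \<in> sets N"
    and eq: "AE z in ?P. ennreal (f z) = (\<Sum>i. ennreal (c i) * indicator (A i \<times> B i) z)"
    using assms(1) unfolding rect_sum_def by blast
  define u where "u i z = c i * indicator (A i \<times> B i) z" for i z
  have [measurable]: "A i \<times> B i \<in> sets ?P" for i using AB by auto
  have [measurable]: "u i \<in> borel_measurable ?P" for i unfolding u_def by measurable
  have nonneg: "0 \<le> u i z" for i z using c by (simp add: u_def)
  have eu: "ennreal (c i) * indicator (A i \<times> B i) z = ennreal (u i z)" for i z
    by (simp add: u_def indicator_def)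
  have eq': "AE z in ?P. ennreal (max 0 (f z)) = (\<Sum>i. ennreal (u i z))"
    using eq by (simp add: eu ennreal_max_0 max.commute)
  have sums: "AE z in ?P. (\<lambda>i. u i z) sums max 0 (f z)"
    using eq'
  proof eventually_elim
    case (elim z)
    then have "summable (\<lambda>i. u i z)"
      using nonneg by (intro summable_suminf_not_top) (auto simp flip: elim)
    moreover from this have "ennreal (\<Sum>i. u i z) = ennreal (max 0 (f z))"
      using nonneg elim by (simp add: suminf_ennreal2)
    then have "(\<Sum>i. u i z) = max 0 (f z)"
      using nonneg suminf_nonneg[OF \<open>summable (\<lambda>i. u i z)\<close>] by (subst (asm) ennreal_inj) auto
    ultimately show ?case by (simp add: sums_iff)
  qed
  have int_max: "integrable ?P (\<lambda>z. max 0 (f z))" using f by auto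
  have int: "integrable ?P (u i)" for i
  proof (rule Bochner_Integration.integrable_bound[OF int_max])
    show "AE z in ?P. norm (u i z) \<le> norm (max 0 (f z))"
      using sums
    proof eventually_elim
      case (elim z)
      then show ?case
        using sum_le_suminf[OF sums_summable[OF elim], of "{i}"] nonneg by (auto simp: sums_iff)
    qed
  qed simp
  have "(\<Sum>i. ennreal (L1_norm ?P (u i))) = (\<Sum>i. \<integral>\<^sup>+z. ennreal (u i z) \<partial>?P)"
    unfolding L1_norm_def using int nonneg
    by (intro suminf_cong) (subst nn_integral_eq_integral, auto)
  also have "\<dots> = (\<integral>\<^sup>+z. (\<Sum>i. ennreal (u i z)) \<partial>?P)"
    by (rule nn_integral_suminf[symmetric]) measurable
  also have "\<dots> = (\<integral>\<^sup>+z. ennreal (max 0 (f z)) \<partial>?P)"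
    using eq' by (intro nn_integral_cong_AE) (auto elim!: eventually_mono)
  also have "\<dots> = ennreal (LINT z|?P. max 0 (f z))"
    using int_max by (intro nn_integral_eq_integral) auto
  finally have tot: "(\<Sum>i. ennreal (L1_norm ?P (u i))) = ennreal (LINT z|?P. max 0 (f z))" .
  have L: "0 \<le> L1_norm ?P (u i)" for i by (simp add: L1_norm_def)
  then have smb: "summable (\<lambda>i. L1_norm ?P (u i))"
    using tot by (intro summable_suminf_not_top) auto
  then have "ennreal (\<Sum>i. L1_norm ?P (u i)) = ennreal (LINT z|?P. max 0 (f z))"
    using tot L by (simp add: suminf_ennreal2)
  then have "(\<Sum>i. L1_norm ?P (u i)) = (LINT z|?P. max 0 (f z))"
    using suminf_nonneg[OF smb] L by (subst (asm) ennreal_inj) auto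
  with smb have "(\<lambda>i. L1_norm ?P (u i)) sums (LINT z|?P. max 0 (f z))" by (simp add: sums_iff)
  then show thesis
    using that[of c A B] c AB int sums unfolding u_def[abs_def] by auto
qed

text \<open>Measurability of the set is what upgrades an equivalence almost everywhere to a null
  symmetric difference.\<close>

lemma ae_countable_rectangle_union_iff:
  assumes S: "{z \<in> space (M \<Otimes>\<^sub>M N). P z} \<in> sets (M \<Otimes>\<^sub>M N)"
  shows "ae_countable_rectangle_union M N {z \<in> space (M \<Otimes>\<^sub>M N). P z} \<longleftrightarrow> rect_union M N P"
proof
  assume "ae_countable_rectangle_union M N {z \<in> space (M \<Otimes>\<^sub>M N). P z}"
  then obtain \<R> where R: "countable \<R>" "\<R> \<subseteq> {A \<times> B | A B. A \<in> sets M \<and> B \<in> sets N}"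
    and null: "sym_diff {z \<in> space (M \<Otimes>\<^sub>M N). P z} (\<Union>\<R>) \<in> null_sets (M \<Otimes>\<^sub>M N)"
    unfolding ae_countable_rectangle_union_def by blast
  \<comment> \<open>Adding the empty rectangle makes the enumeration by \<open>nat\<close> possible
    even if \<open>\<R>\<close> is empty.\<close>
  define r where "r = from_nat_into (insert {} \<R>)"
  have r: "range r = insert {} \<R>" unfolding r_def using R by simp
  have "\<forall>i. \<exists>A B. r i = A \<times> B \<and> A \<in> sets M \<and> B \<in> sets N"
  proof
    fix i
    have "r i \<in> insert {} \<R>" using r by blast
    then show "\<exists>A B. r i = A \<times> B \<and> A \<in> sets M \<and> B \<in> sets N"
    proof
      assume "r i = {}"
      then show ?thesis by (intro exI[of _ "{}"]) simp
    qed (use R in blast)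
  qed
  then obtain A B where AB: "\<And>i. r i = A i \<times> B i" "\<And>i. A i \<in> sets M" "\<And>i. B i \<in> sets N"
    unfolding choice_iff by blast
  have "AE z in M \<Otimes>\<^sub>M N. P z \<longleftrightarrow> (\<exists>i. z \<in> A i \<times> B i)"
    using AE_not_in[OF null] AE_space
  proof eventually_elim
    case (elim z)
    have "z \<in> \<Union>\<R> \<longleftrightarrow> z \<in> \<Union>(range r)" unfolding r by simp
    also have "\<dots> \<longleftrightarrow> (\<exists>i. z \<in> A i \<times> B i)" by (simp add: AB)
    finally show ?case using elim by blast
  qed
  then show "rect_union M N P"
    unfolding rect_union_def using AB by (intro exI[of _ A] exI[of _ B]) simp
next
  assume "rect_union M N P"
  then obtain A B where AB: "\<And>i::nat. A i \<in> sets M \<and> B i \<in> sets N"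
    and ae: "AE z in M \<Otimes>\<^sub>M N. P z \<longleftrightarrow> (\<exists>i. z \<in> A i \<times> B i)"
    unfolding rect_union_def by blast
  define \<R> where "\<R> = range (\<lambda>i. A i \<times> B i)"
  have "\<Union>\<R> \<in> sets (M \<Otimes>\<^sub>M N)" unfolding \<R>_def using AB by (intro sets.countable_UN) auto
  then have "sym_diff {z \<in> space (M \<Otimes>\<^sub>M N). P z} (\<Union>\<R>) \<in> sets (M \<Otimes>\<^sub>M N)" using S by auto
  moreover have "AE z in M \<Otimes>\<^sub>M N. z \<notin> sym_diff {z \<in> space (M \<Otimes>\<^sub>M N). P z} (\<Union>\<R>)"
    using ae AE_space by eventually_elim (auto simp: \<R>_def)
  ultimately have "sym_diff {z \<in> space (M \<Otimes>\<^sub>M N). P z} (\<Union>\<R>) \<in> null_sets (M \<Otimes>\<^sub>M N)"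
    by (simp add: AE_iff_null_sets)
  moreover have "countable \<R>" "\<R> \<subseteq> {A \<times> B | A B. A \<in> sets M \<and> B \<in> sets N}"
    unfolding \<R>_def using AB by auto
  ultimately show "ae_countable_rectangle_union M N {z \<in> space (M \<Otimes>\<^sub>M N). P z}"
    unfolding ae_countable_rectangle_union_def by blast
qed

lemma rect_sum_real_iff_superlevel:
  fixes f :: "'a \<times> 'b \<Rightarrow> real"
  shows "rect_sum M N (\<lambda>z. ennreal (f z)) \<longleftrightarrow> (\<forall>c\<ge>0. rect_union M N (\<lambda>z. c < f z))"
proof
  assume r: "rect_sum M N (\<lambda>z. ennreal (f z))"
  show "\<forall>c\<ge>0. rect_union M N (\<lambda>z. c < f z)"
  proof (intro allI impI)
    fix c :: real assume "0 \<le> c"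
    then show "rect_union M N (\<lambda>z. c < f z)"
      using rect_sum_superlevel[OF r, of "ennreal c"] by (simp add: ennreal_less_iff)
  qed
qed (auto intro: superlevel_rect_sum)

lemma fun_tensor_indicator:
  "fun_tensor (indicator A) (indicator B) = (indicator (A \<times> B) :: _ \<Rightarrow> real)"
  by (auto simp: fun_tensor_def indicator_def fun_eq_iff)

text \<open>Forward, the disjointness condition lets at most one of the two series be nonzero at
  almost every point, so \<open>p\<close> and \<open>q\<close> are the positive and negative parts
  of \<open>f\<close>. Backward, a rectangle with positive coefficient lies, up to a null set, where
  the corresponding part of \<open>f\<close> is positive, and the two parts are never positive
  together.\<close>

lemma rectangle_decomposable_iff:
  assumes f: "integrable (M \<Otimes>\<^sub>M N) f"
  shows "rectangle_decomposable M N f \<longleftrightarrow>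
    rect_sum M N (\<lambda>z. ennreal (f z)) \<and> rect_sum M N (\<lambda>z. ennreal (- f z))"
proof
  let ?P = "M \<Otimes>\<^sub>M N"
  assume "rectangle_decomposable M N f"
  then show "rect_sum M N (\<lambda>z. ennreal (f z)) \<and> rect_sum M N (\<lambda>z. ennreal (- f z))"
    unfolding rectangle_decomposable_def fun_tensor_indicator
  proof (elim exE conjE)
    fix c d :: "nat \<Rightarrow> real" and A B C D p q
    assume c: "\<forall>i. 0 \<le> c i" and d: "\<forall>j. 0 \<le> d j"
      and AB: "\<forall>i. A i \<in> sets M \<and> B i \<in> sets N" and CD: "\<forall>j. C j \<in> sets M \<and> D j \<in> sets N"
      and disj: "\<forall>i j. c i * d j \<noteq> 0 \<longrightarrow> emeasure ?P ((A i \<times> B i) \<inter> (C j \<times> D j)) = 0"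
      and p: "L1_sums ?P (\<lambda>i z. c i * indicator (A i \<times> B i) z) p"
      and q: "L1_sums ?P (\<lambda>j z. d j * indicator (C j \<times> D j) z) q"
      and fpq: "AE z in ?P. f z = p z - q z"
    have sums: "AE z in ?P. (\<lambda>i. c i * indicator (A i \<times> B i) z) sums p z"
      if "L1_sums ?P (\<lambda>i z. c i * indicator (A i \<times> B i) z) p" "\<And>i. 0 \<le> c i" for c :: "nat \<Rightarrow> real" and A B p
      using that summable_L1_norm_nonneg[OF that(1)]
      by (subst L1_sums_iff[symmetric]) (auto simp: L1_sums_def)
    have nn: "0 \<le> t" "ennreal t = (\<Sum>i. ennreal (c i) * indicator (A i \<times> B i) z)"
      if "(\<lambda>i. c i * indicator (A i \<times> B i) z) sums t" "\<And>i. 0 \<le> c i" for c :: "nat \<Rightarrow> real" and A B and t and z :: "'a \<times> 'b"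
    proof -
      have "ennreal (c i) * indicator (A i \<times> B i) z = ennreal (c i * indicator (A i \<times> B i) z)" for i
        by (simp add: indicator_def)
      moreover have "(\<Sum>i. ennreal (c i * indicator (A i \<times> B i) z)) = ennreal t"
        using that(2) by (intro suminf_ennreal_eq[OF _ that(1)]) simp
      ultimately show "ennreal t = (\<Sum>i. ennreal (c i) * indicator (A i \<times> B i) z)"
        by (simp only:)
      show "0 \<le> t" using that by (intro sums_le[OF _ sums_zero that(1)]) simp
    qed
    have "AE z in ?P. z \<notin> (A i \<times> B i) \<inter> (C j \<times> D j)" if "c i * d j \<noteq> 0" for i j
      using disj that AB CD by (intro AE_not_in null_setsI) auto
    then have "AE z in ?P. \<forall>i j. c i * d j \<noteq> 0 \<longrightarrow> z \<notin> (A i \<times> B i) \<inter> (C j \<times> D j)"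
      by (simp add: AE_all_countable)
    with sums[OF p c[rule_format]] sums[OF q d[rule_format]] fpq
    have "AE z in ?P. ennreal (f z) = (\<Sum>i. ennreal (c i) * indicator (A i \<times> B i) z) \<and>
        ennreal (- f z) = (\<Sum>i. ennreal (d i) * indicator (C i \<times> D i) z)"
    proof eventually_elim
      case (elim z)
      have "p z = 0 \<or> q z = 0"
      proof (rule ccontr)
        assume "\<not> (p z = 0 \<or> q z = 0)"
        then have "p z \<noteq> 0" "q z \<noteq> 0" by auto
        then obtain i j where "c i * indicator (A i \<times> B i) z \<noteq> 0" "d j * indicator (C j \<times> D j) z \<noteq> 0"
          using sums_0[THEN sums_unique2, OF _ elim(1)] sums_0[THEN sums_unique2, OF _ elim(2)] by metis
        then show False using elim(4) by (auto simp: indicator_def split: if_splits)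
      qed
      then show ?case
        using nn[OF elim(1) c[rule_format]] nn[OF elim(2) d[rule_format]] elim(3) by (auto simp: ennreal_neg)
    qed
    then show "rect_sum M N (\<lambda>z. ennreal (f z)) \<and> rect_sum M N (\<lambda>z. ennreal (- f z))"
      unfolding rect_sum_def using AB CD c d
      by (intro conjI exI[of _ c] exI[of _ A] exI[of _ B] exI[of _ d] exI[of _ C] exI[of _ D]) simp_all
  qed
next
  let ?P = "M \<Otimes>\<^sub>M N"
  assume r: "rect_sum M N (\<lambda>z. ennreal (f z)) \<and> rect_sum M N (\<lambda>z. ennreal (- f z))"
  obtain c :: "nat \<Rightarrow> real" and A B where c: "\<And>i. 0 \<le> c i" and AB: "\<And>i. A i \<in> sets M" "\<And>i. B i \<in> sets N"
    and intc: "\<And>i. integrable ?P (\<lambda>z. c i * indicator (A i \<times> B i) z)"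
    and sumc: "AE z in ?P. (\<lambda>i. c i * indicator (A i \<times> B i) z) sums max 0 (f z)"
    and nc: "(\<lambda>i. L1_norm ?P (\<lambda>z. c i * indicator (A i \<times> B i) z)) sums (LINT z|?P. max 0 (f z))"
    by (rule rect_sum_expand[OF r[THEN conjunct1] f], rule that)
  have f': "integrable ?P (\<lambda>z. - f z)" using f by simp
  obtain d :: "nat \<Rightarrow> real" and C D where d: "\<And>i. 0 \<le> d i" and CD: "\<And>i. C i \<in> sets M" "\<And>i. D i \<in> sets N"
    and intd: "\<And>i. integrable ?P (\<lambda>z. d i * indicator (C i \<times> D i) z)"
    and sumd: "AE z in ?P. (\<lambda>i. d i * indicator (C i \<times> D i) z) sums max 0 (- f z)"
    and nd: "(\<lambda>i. L1_norm ?P (\<lambda>z. d i * indicator (C i \<times> D i) z)) sums (LINT z|?P. max 0 (- f z))"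
    by (rule rect_sum_expand[OF r[THEN conjunct2] f'], rule that)
  have 1: "L1_sums ?P (\<lambda>i z. c i * indicator (A i \<times> B i) z) (\<lambda>z. max 0 (f z))"
    using intc sumc sums_summable[OF nc] f by (subst L1_sums_iff) auto
  have 2: "L1_sums ?P (\<lambda>i z. d i * indicator (C i \<times> D i) z) (\<lambda>z. max 0 (- f z))"
    using intd sumd sums_summable[OF nd] f by (subst L1_sums_iff) auto
  have 3: "emeasure ?P ((A i \<times> B i) \<inter> (C j \<times> D j)) = 0" if cd: "c i * d j \<noteq> 0" for i j
  proof -
    have pos: "0 < t" if "(\<lambda>i. c i * indicator (A i \<times> B i) z) sums t" "\<And>i. 0 \<le> c i"
      "c i \<noteq> 0" "z \<in> A i \<times> B i" for c :: "nat \<Rightarrow> real" and A B and z :: "'a \<times> 'b" and t i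
    proof -
      have "0 < (\<Sum>i. c i * indicator (A i \<times> B i) z)"
        using that by (intro suminf_pos2[of _ i] sums_summable[OF that(1)]) (auto simp: less_le)
      then show ?thesis using that(1) by (simp add: sums_iff)
    qed
    have "AE z in ?P. z \<notin> (A i \<times> B i) \<inter> (C j \<times> D j)"
      using sumc sumd
    proof eventually_elim
      case (elim z)
      show ?case
      proof
        assume z: "z \<in> (A i \<times> B i) \<inter> (C j \<times> D j)"
        have "0 < max 0 (f z)" "0 < max 0 (- f z)"
          using pos[OF elim(1) c, of i] pos[OF elim(2) d, of j] cd z by auto
        then show False by auto
      qed
    qed
    moreover have "(A i \<times> B i) \<inter> (C j \<times> D j) \<in> sets ?P" using AB CD by auto
    ultimately show ?thesis using AE_iff_null_sets null_setsD1 by blast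
  qed
  have 4: "AE z in ?P. f z = max 0 (f z) - max 0 (- f z)" by auto
  show "rectangle_decomposable M N f"
    unfolding rectangle_decomposable_def fun_tensor_indicator
    by (intro exI[of _ c] exI[of _ d] exI[of _ A] exI[of _ B] exI[of _ C] exI[of _ D]
        exI[of _ "\<lambda>z. max 0 (f z)"] exI[of _ "\<lambda>z. max 0 (- f z)"]
        conjI allI impI c d AB CD 1 2 3 4)
qed

lemma rectangle_decomposable_iff_superlevel:
  fixes f :: "'a \<times> 'b \<Rightarrow> real"
  assumes f: "integrable (M \<Otimes>\<^sub>M N) f"
  shows "rectangle_decomposable M N f \<longleftrightarrow>
    (\<forall>c\<ge>0. ae_countable_rectangle_union M N {z \<in> space (M \<Otimes>\<^sub>M N). f z > c} \<and>
           ae_countable_rectangle_union M N {z \<in> space (M \<Otimes>\<^sub>M N). f z < - c})"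
proof -
  have [measurable]: "f \<in> borel_measurable (M \<Otimes>\<^sub>M N)" using f by auto
  have "{z \<in> space (M \<Otimes>\<^sub>M N). c < f z} \<in> sets (M \<Otimes>\<^sub>M N)"
    "{z \<in> space (M \<Otimes>\<^sub>M N). f z < - c} \<in> sets (M \<Otimes>\<^sub>M N)" for c by measurable
  note iff = this[THEN ae_countable_rectangle_union_iff]
  have "(\<lambda>z. c < - f z) = (\<lambda>z. f z < - c)" for c by auto
  then show ?thesis
    unfolding rectangle_decomposable_iff[OF f] rect_sum_real_iff_superlevel iff by auto
qed


subsection \<open>Series of elementary tensors\<close>

text \<open>The real \<open>t\<close> is the cost of a representation, and convergence is taken
  almost everywhere instead of in mean. For integrable \<open>u\<close> the possible costs form the
  set whose infimum is \<open>proj_norm\<close>, so that costs can be handled without naming the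
  factors.\<close>

definition tensor_series ::
    "'a measure \<Rightarrow> 'b measure \<Rightarrow>
     ('a \<times> 'b \<Rightarrow> 'k::{real_normed_field,banach,second_countable_topology}) \<Rightarrow> real \<Rightarrow> bool"
  where "tensor_series M N u t \<longleftrightarrow>
    (\<exists>g h. (\<forall>i. integrable M (g i)) \<and> (\<forall>i. integrable N (h i)) \<and>
      (\<lambda>i. L1_norm M (g i) * L1_norm N (h i)) sums t \<and>
      (AE z in M \<Otimes>\<^sub>M N. (\<lambda>i. fun_tensor (g i) (h i) z) sums u z))"

lemma tensor_seriesI:
  assumes "\<And>i. integrable M (g i)" "\<And>i. integrable N (h i)"
    and "(\<lambda>i. L1_norm M (g i) * L1_norm N (h i)) sums t"
    and "AE z in M \<Otimes>\<^sub>M N. (\<lambda>i. fun_tensor (g i) (h i) z) sums u z"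
  shows "tensor_series M N u t"
  unfolding tensor_series_def by (intro exI[of _ g] exI[of _ h] conjI allI assms)

lemma tensor_seriesE:
  assumes "tensor_series M N u t"
  obtains g h where "\<And>i. integrable M (g i)" "\<And>i. integrable N (h i)"
    "(\<lambda>i. L1_norm M (g i) * L1_norm N (h i)) sums t"
    "AE z in M \<Otimes>\<^sub>M N. (\<lambda>i. fun_tensor (g i) (h i) z) sums u z"
  using assms unfolding tensor_series_def by (elim exE conjE) (rule that, simp_all)

lemma L1_norm_nonneg [simp]: "0 \<le> L1_norm M g"
  by (simp add: L1_norm_def)

lemma L1_norm_zero [simp]: "L1_norm M (\<lambda>_. 0) = 0"
  by (simp add: L1_norm_def)

lemma L1_norm_uminus [simp]: "L1_norm M (\<lambda>x. - g x) = L1_norm M g"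
  by (simp add: L1_norm_def)

text \<open>Absolute summability along the enumeration gives an unconditional sum over all pairs. It
  may be evaluated row by row, and uniqueness of sums identifies it with \<open>s\<close>.\<close>

lemma sums_prod_decode:
  fixes f :: "nat \<times> nat \<Rightarrow> 'k::banach"
  assumes norm: "summable (\<lambda>m. norm (f (prod_decode m)))"
    and a: "\<And>n. (\<lambda>i. f (n, i)) sums a n" and s: "a sums s"
  shows "(\<lambda>m. f (prod_decode m)) sums s"
proof -
  define S where "S = (\<Sum>m. f (prod_decode m))"
  have S: "(\<lambda>m. f (prod_decode m)) sums S"
    unfolding S_def by (rule summable_sums[OF summable_norm_cancel[OF norm]])
  have "((\<lambda>m. f (prod_decode m)) has_sum S) UNIV"
    by (rule norm_summable_imp_has_sum[OF norm S])
  then have f: "(f has_sum S) (Sigma UNIV (\<lambda>_. UNIV))"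
    by (subst (asm) has_sum_reindex_bij_betw[OF bij_prod_decode]) simp
  have inner: "((\<lambda>i. f (n, i)) has_sum a n) UNIV" for n
  proof (rule norm_summable_imp_has_sum[OF _ a])
    have "inj (\<lambda>i. prod_encode (n, i))" by (auto intro: injI)
    have "(\<lambda>m. norm (f (prod_decode m))) summable_on range (\<lambda>i. prod_encode (n, i))"
      using norm by (intro summable_on_subset_banach[OF norm_summable_imp_summable_on]) auto
    then have "(\<lambda>i. norm (f (n, i))) summable_on UNIV"
      using summable_on_reindex[OF \<open>inj _\<close>, of "\<lambda>m. norm (f (prod_decode m))"] by (simp add: comp_def)
    then show "summable (\<lambda>i. norm (f (n, i)))" by (rule summable_on_imp_summable)
  qed
  have "(a has_sum S) UNIV" by (rule has_sum_SigmaD[OF f inner])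
  then have "a sums S" by (rule has_sum_imp_sums)
  with s have "S = s" by (rule sums_unique2[symmetric])
  with S show ?thesis by simp
qed

text \<open>For nonnegative terms, summability along the enumeration follows from the iterated sums,
  compared in \<open>ennreal\<close>, where the order of summation is immaterial.\<close>

lemma nonneg_sums_prod_decode:
  fixes f :: "nat \<times> nat \<Rightarrow> real"
  assumes nonneg: "\<And>p. 0 \<le> f p" and a: "\<And>n. (\<lambda>i. f (n, i)) sums a n" and s: "a sums s"
  shows "(\<lambda>m. f (prod_decode m)) sums s"
proof -
  have a0: "0 \<le> a n" for n using sums_le[OF _ sums_zero a[of n]] nonneg by auto
  have "ennreal (a n) = (\<Sum>i. ennreal (f (n, i)))" for n
    using nonneg by (intro suminf_ennreal_eq[OF _ a, symmetric])
  then have "(\<Sum>m. ennreal (f (prod_decode m))) = (\<Sum>n. ennreal (a n))"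
    by (intro suminf_ennreal_2dimen)
  also have "\<dots> = ennreal s" using a0 s by (rule suminf_ennreal_eq)
  finally have "summable (\<lambda>m. f (prod_decode m))"
    using nonneg by (intro summable_suminf_not_top) auto
  then show ?thesis using nonneg by (intro sums_prod_decode[OF _ a s]) simp
qed

lemma fun_tensor_measurable [measurable]:
  fixes g :: "'a \<Rightarrow> 'k::{real_normed_field,second_countable_topology}"
  assumes [measurable]: "g \<in> borel_measurable M" "h \<in> borel_measurable N"
  shows "fun_tensor g h \<in> borel_measurable (M \<Otimes>\<^sub>M N)"
  unfolding fun_tensor_def by measurable

context pair_sigma_finite
begin

lemma
  fixes g :: "'a \<Rightarrow> 'k::{real_normed_field,banach,second_countable_topology}"
  assumes g: "integrable M1 g" and h: "integrable M2 h"
  shows integrable_fun_tensor: "integrable (M1 \<Otimes>\<^sub>M M2) (fun_tensor g h)"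
    and L1_norm_fun_tensor: "L1_norm (M1 \<Otimes>\<^sub>M M2) (fun_tensor g h) = L1_norm M1 g * L1_norm M2 h"
proof -
  have [measurable]: "g \<in> borel_measurable M1" "h \<in> borel_measurable M2" using g h by auto
  have "(\<integral>\<^sup>+z. norm (fun_tensor g h z) \<partial>(M1 \<Otimes>\<^sub>M M2)) =
      (\<integral>\<^sup>+x. \<integral>\<^sup>+y. norm (fun_tensor g h (x, y)) \<partial>M2 \<partial>M1)"
    by (rule M2.nn_integral_fst[symmetric]) measurable
  also have "\<dots> = (\<integral>\<^sup>+x. ennreal (norm (g x)) * (\<integral>\<^sup>+y. norm (h y) \<partial>M2) \<partial>M1)"
    by (simp add: fun_tensor_def norm_mult ennreal_mult nn_integral_cmult)
  also have "\<dots> = ennreal (L1_norm M1 g) * ennreal (L1_norm M2 h)"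
    using g h by (simp add: nn_integral_multc nn_integral_eq_integral L1_norm_def)
  also have "\<dots> = ennreal (L1_norm M1 g * L1_norm M2 h)" by (simp add: ennreal_mult)
  finally have *: "(\<integral>\<^sup>+z. norm (fun_tensor g h z) \<partial>(M1 \<Otimes>\<^sub>M M2)) = ennreal (L1_norm M1 g * L1_norm M2 h)" .
  then show "integrable (M1 \<Otimes>\<^sub>M M2) (fun_tensor g h)"
    by (intro integrableI_bounded) auto
  show "L1_norm (M1 \<Otimes>\<^sub>M M2) (fun_tensor g h) = L1_norm M1 g * L1_norm M2 h"
    unfolding L1_norm_def[of "M1 \<Otimes>\<^sub>M M2"] using *
    by (subst integral_eq_nn_integral) auto
qed

lemma tensor_series_iff:
  fixes u :: "'a \<times> 'b \<Rightarrow> 'k::{real_normed_field,banach,second_countable_topology}"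
  assumes u: "integrable (M1 \<Otimes>\<^sub>M M2) u"
  shows "tensor_series M1 M2 u t \<longleftrightarrow>
    (\<exists>g h. proj_representation M1 M2 g h u \<and> t = (\<Sum>i. L1_norm M1 (g i) * L1_norm M2 (h i)))"
proof -
  have "L1_sums (M1 \<Otimes>\<^sub>M M2) (\<lambda>i. fun_tensor (g i) (h i)) u \<longleftrightarrow>
      (AE z in M1 \<Otimes>\<^sub>M M2. (\<lambda>i. fun_tensor (g i) (h i) z) sums u z)"
    if "\<forall>i. integrable M1 (g i)" "\<forall>i. integrable M2 (h i)"
      "summable (\<lambda>i. L1_norm M1 (g i) * L1_norm M2 (h i))" for g h
    using that u by (intro L1_sums_iff) (auto simp: L1_norm_fun_tensor intro: integrable_fun_tensor)
  then show ?thesis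
    unfolding tensor_series_def proj_representation_def by (auto simp: sums_iff)
qed

lemma L1_norm_le_tensor_series:
  fixes u :: "'a \<times> 'b \<Rightarrow> 'k::{real_normed_field,banach,second_countable_topology}"
  assumes u: "integrable (M1 \<Otimes>\<^sub>M M2) u" and "tensor_series M1 M2 u t"
  shows "L1_norm (M1 \<Otimes>\<^sub>M M2) u \<le> t"
proof -
  obtain g h where g: "\<And>i. integrable M1 (g i)" and h: "\<And>i. integrable M2 (h i)"
    and t: "(\<lambda>i. L1_norm M1 (g i) * L1_norm M2 (h i)) sums t"
    and ae: "AE z in M1 \<Otimes>\<^sub>M M2. (\<lambda>i. fun_tensor (g i) (h i) z) sums u z"
    by (rule tensor_seriesE[OF assms(2)], rule that)
  let ?v = "\<lambda>i. fun_tensor (g i) (h i)"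
  have s: "summable (\<lambda>i. L1_norm (M1 \<Otimes>\<^sub>M M2) (?v i))"
    using t g h by (simp add: L1_norm_fun_tensor sums_iff)
  have int: "integrable (M1 \<Otimes>\<^sub>M M2) (?v i)" for i using g h by (rule integrable_fun_tensor)
  have "L1_norm (M1 \<Otimes>\<^sub>M M2) u \<le> (LINT z|(M1 \<Otimes>\<^sub>M M2). (\<Sum>i. norm (?v i z)))"
    unfolding L1_norm_def
  proof (rule integral_mono_AE)
    show "AE z in M1 \<Otimes>\<^sub>M M2. norm (u z) \<le> (\<Sum>i. norm (?v i z))"
      using ae AE_summable_norm[OF int s]
      by eventually_elim (metis summable_norm sums_iff)
  qed (use u integrable_sum_norm(1)[OF int s] in auto)
  also have "\<dots> = t"
    using integrable_sum_norm(2)[OF int s] t g h by (simp add: L1_norm_fun_tensor sums_iff)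
  finally show ?thesis .
qed

text \<open>Costs are countably additive: the double family of tensors is listed along
  \<open>prod_decode\<close>, its costs are nonnegative and sum to \<open>T\<close>, and the
  resulting absolute summability permits the rearrangement at almost every point.\<close>

lemma tensor_series_suminf:
  fixes u :: "nat \<Rightarrow> 'a \<times> 'b \<Rightarrow> 'k::{real_normed_field,banach,second_countable_topology}"
  assumes u: "\<And>n. tensor_series M1 M2 (u n) (t n)" and t: "t sums T"
    and ae: "AE z in M1 \<Otimes>\<^sub>M M2. (\<lambda>n. u n z) sums w z"
  shows "tensor_series M1 M2 w T"
proof -
  have "\<forall>n. \<exists>g h. (\<forall>i. integrable M1 (g i)) \<and> (\<forall>i. integrable M2 (h i)) \<and>
      (\<lambda>i. L1_norm M1 (g i) * L1_norm M2 (h i)) sums t n \<and>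
      (AE z in M1 \<Otimes>\<^sub>M M2. (\<lambda>i. fun_tensor (g i) (h i) z) sums u n z)"
    using u unfolding tensor_series_def by simp
  then obtain g h where g: "\<And>n i. integrable M1 (g n i)" and h: "\<And>n i. integrable M2 (h n i)"
    and tn: "\<And>n. (\<lambda>i. L1_norm M1 (g n i) * L1_norm M2 (h n i)) sums t n"
    and un: "\<And>n. AE z in M1 \<Otimes>\<^sub>M M2. (\<lambda>i. fun_tensor (g n i) (h n i) z) sums u n z"
    unfolding choice_iff by blast
  define G where "G m = case_prod g (prod_decode m)" for m
  define H where "H m = case_prod h (prod_decode m)" for m
  have G: "integrable M1 (G m)" and H: "integrable M2 (H m)" for m
    using g h by (auto simp: G_def H_def split: prod.split)
  have T: "(\<lambda>m. L1_norm M1 (G m) * L1_norm M2 (H m)) sums T"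
    using nonneg_sums_prod_decode[of "\<lambda>(n, i). L1_norm M1 (g n i) * L1_norm M2 (h n i)", OF _ _ t] tn
    by (simp add: G_def H_def split_beta)
  have s: "summable (\<lambda>i. L1_norm (M1 \<Otimes>\<^sub>M M2) (fun_tensor (G i) (H i)))"
    using T G H by (simp add: L1_norm_fun_tensor sums_iff)
  have "AE z in M1 \<Otimes>\<^sub>M M2. \<forall>n. (\<lambda>i. fun_tensor (g n i) (h n i) z) sums u n z"
    using un by (simp add: AE_all_countable)
  moreover have "AE z in M1 \<Otimes>\<^sub>M M2. summable (\<lambda>i. norm (fun_tensor (G i) (H i) z))"
    by (rule AE_summable_norm[OF integrable_fun_tensor[OF G H] s])
  ultimately have "AE z in M1 \<Otimes>\<^sub>M M2. (\<lambda>m. fun_tensor (G m) (H m) z) sums w z"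
    using ae
  proof eventually_elim
    case (elim z)
    then show ?case
      using sums_prod_decode[of "\<lambda>(n, i). fun_tensor (g n i) (h n i) z" "\<lambda>n. u n z" "w z"]
      by (simp add: G_def H_def split_beta)
  qed
  with G H T show ?thesis by (rule tensor_seriesI)
qed

lemma tensor_series_zero: "tensor_series M1 M2 (\<lambda>_. 0) 0"
  unfolding tensor_series_def
  by (intro exI[of _ "\<lambda>_ _. 0"]) (simp add: fun_tensor_def split_beta)

lemma tensor_series_uminus:
  assumes "tensor_series M1 M2 u t"
  shows "tensor_series M1 M2 (\<lambda>z. - u z) t"
proof -
  obtain g h where gh: "\<And>i. integrable M1 (g i)" "\<And>i. integrable M2 (h i)"
    "(\<lambda>i. L1_norm M1 (g i) * L1_norm M2 (h i)) sums t"
    and ae: "AE z in M1 \<Otimes>\<^sub>M M2. (\<lambda>i. fun_tensor (g i) (h i) z) sums u z"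
    by (rule tensor_seriesE[OF assms], rule that)
  have eq: "fun_tensor (\<lambda>x. - g i x) (h i) z = - fun_tensor (g i) (h i) z" for i z
    by (simp add: fun_tensor_def split_beta)
  have "AE z in M1 \<Otimes>\<^sub>M M2. (\<lambda>i. fun_tensor (\<lambda>x. - g i x) (h i) z) sums - u z"
    using ae by eventually_elim (simp only: eq sums_minus)
  with gh show ?thesis by (intro tensor_seriesI[of _ "\<lambda>i x. - g i x" _ h]) simp_all
qed

lemma sums_pair:
  fixes a b :: "'z::real_normed_vector"
  shows "(\<lambda>n. if n = (0::nat) then a else if n = 1 then b else 0) sums (a + b)"
  using sums_finite[of "{0, 1::nat}" "\<lambda>n. if n = 0 then a else if n = 1 then b else 0"] by simp

lemma tensor_series_add:
  assumes "tensor_series M1 M2 u s" "tensor_series M1 M2 v t"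
  shows "tensor_series M1 M2 (\<lambda>z. u z + v z) (s + t)"
proof -
  \<comment> \<open>A sum of two functions is a series padded with zero functions of cost 0.\<close>
  let ?w = "\<lambda>n::nat. if n = 0 then u else if n = 1 then v else (\<lambda>_. 0)"
  let ?r = "\<lambda>n::nat. if n = 0 then s else if n = 1 then t else 0"
  show ?thesis
  proof (rule tensor_series_suminf)
    show "tensor_series M1 M2 (?w n) (?r n)" for n
      by (simp add: assms tensor_series_zero)
    show "?r sums (s + t)" by (rule sums_pair)
    have "(\<lambda>n. ?w n z) = (\<lambda>n. if n = 0 then u z else if n = 1 then v z else 0)" for z by auto
    then have "(\<lambda>n. ?w n z) sums (u z + v z)" for z by (simp only: sums_pair)
    then show "AE z in M1 \<Otimes>\<^sub>M M2. (\<lambda>n. ?w n z) sums (u z + v z)" by (rule AE_I2)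
  qed
qed

text \<open>Integrability of the weighted rectangle does not make both sides of finite measure:
  \<open>c\<close> may be 0, or one side null and the other infinite. In these cases the function
  vanishes almost everywhere and a zero tensor is used; otherwise both sides have finite measure.
  The cost is computed uniformly from \<open>L1_norm_fun_tensor\<close>.\<close>

lemma rect_tensor:
  assumes A: "A \<in> sets M1" and B: "B \<in> sets M2"
    and int: "integrable (M1 \<Otimes>\<^sub>M M2) (\<lambda>z. c * indicator (A \<times> B) z :: real)"
  shows "\<exists>g h. integrable M1 g \<and> integrable M2 h \<and>
    L1_norm M1 g * L1_norm M2 h = L1_norm (M1 \<Otimes>\<^sub>M M2) (\<lambda>z. c * indicator (A \<times> B) z) \<and>
    (AE z in M1 \<Otimes>\<^sub>M M2. fun_tensor g h z = c * indicator (A \<times> B) z)"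
proof -
  have AB: "A \<times> B \<in> sets (M1 \<Otimes>\<^sub>M M2)" using A B by auto
  have "\<exists>g h. integrable M1 g \<and> integrable M2 h \<and>
    (AE z in M1 \<Otimes>\<^sub>M M2. fun_tensor g h z = c * indicator (A \<times> B) z)"
  proof (cases "c = 0 \<or> emeasure (M1 \<Otimes>\<^sub>M M2) (A \<times> B) = 0")
    case True
    have "AE z in M1 \<Otimes>\<^sub>M M2. 0 = c * indicator (A \<times> B) z"
    proof (cases "c = 0")
      case False
      with True AB have "AE z in M1 \<Otimes>\<^sub>M M2. z \<notin> A \<times> B" by (intro AE_not_in null_setsI) auto
      then show ?thesis by eventually_elim simp
    qed simp
    then show ?thesis
      by (intro exI[of _ "\<lambda>_. 0"]) (simp add: fun_tensor_def)
  next
    case False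
    have "integrable (M1 \<Otimes>\<^sub>M M2) (\<lambda>z. indicator (A \<times> B) z :: real)"
      using integrable_mult_right[OF int, of "inverse c"] False by (simp add: mult.assoc[symmetric])
    then have "emeasure (M1 \<Otimes>\<^sub>M M2) (A \<times> B) < \<infinity>"
      using AB by (subst (asm) integrable_indicator_iff) (auto simp: sets.Int_space_eq2)
    then have "emeasure M1 A * emeasure M2 B < \<infinity>" "emeasure M1 A * emeasure M2 B \<noteq> 0"
      using False A B by (auto simp: M2.emeasure_pair_measure_Times)
    then have "emeasure M1 A < \<infinity>" "emeasure M2 B < \<infinity>"
      by (auto simp: ennreal_mult_eq_top_iff simp flip: top.not_eq_extremum)
    then have "integrable M1 (\<lambda>x. c * indicator A x)" "integrable M2 (indicator B :: _ \<Rightarrow> real)"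
      using A B by (auto intro!: integrable_real_indicator)
    moreover have "fun_tensor (\<lambda>x. c * indicator A x) (indicator B) z = c * indicator (A \<times> B) z" for z
      by (cases z) (simp add: fun_tensor_def indicator_def)
    ultimately show ?thesis by blast
  qed
  then obtain g h where g: "integrable M1 g" and h: "integrable M2 h"
    and ae: "AE z in M1 \<Otimes>\<^sub>M M2. fun_tensor g h z = c * indicator (A \<times> B) z" by blast
  have [measurable]: "g \<in> borel_measurable M1" "h \<in> borel_measurable M2" using g h by auto
  have "L1_norm (M1 \<Otimes>\<^sub>M M2) (fun_tensor g h) = L1_norm (M1 \<Otimes>\<^sub>M M2) (\<lambda>z. c * indicator (A \<times> B) z)"
    unfolding L1_norm_def using ae int by (intro integral_cong_AE) (auto elim!: eventually_mono)
  with L1_norm_fun_tensor[OF g h]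
  have "L1_norm M1 g * L1_norm M2 h = L1_norm (M1 \<Otimes>\<^sub>M M2) (\<lambda>z. c * indicator (A \<times> B) z)" by simp
  then show ?thesis by (intro exI[of _ g] exI[of _ h] conjI g h ae)
qed

lemma rect_sum_tensor_series:
  assumes r: "rect_sum M1 M2 (\<lambda>z. ennreal (f z))" and f: "integrable (M1 \<Otimes>\<^sub>M M2) f"
  shows "tensor_series M1 M2 (\<lambda>z. max 0 (f z)) (LINT z|(M1 \<Otimes>\<^sub>M M2). max 0 (f z))"
proof -
  obtain c :: "nat \<Rightarrow> real" and A B where AB: "\<And>i. A i \<in> sets M1" "\<And>i. B i \<in> sets M2"
    and int: "\<And>i. integrable (M1 \<Otimes>\<^sub>M M2) (\<lambda>z. c i * indicator (A i \<times> B i) z)"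
    and sums: "AE z in M1 \<Otimes>\<^sub>M M2. (\<lambda>i. c i * indicator (A i \<times> B i) z) sums max 0 (f z)"
    and norm: "(\<lambda>i. L1_norm (M1 \<Otimes>\<^sub>M M2) (\<lambda>z. c i * indicator (A i \<times> B i) z)) sums
      (LINT z|(M1 \<Otimes>\<^sub>M M2). max 0 (f z))"
    by (rule rect_sum_expand[OF r f], rule that)
  have "\<forall>i. \<exists>g h. integrable M1 g \<and> integrable M2 h \<and>
    L1_norm M1 g * L1_norm M2 h = L1_norm (M1 \<Otimes>\<^sub>M M2) (\<lambda>z. c i * indicator (A i \<times> B i) z) \<and>
    (AE z in M1 \<Otimes>\<^sub>M M2. fun_tensor g h z = c i * indicator (A i \<times> B i) z)"
    using rect_tensor[OF AB int] by (rule allI)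
  then obtain g h where gh: "\<And>i. integrable M1 (g i)" "\<And>i. integrable M2 (h i)"
    and n: "\<And>i. L1_norm M1 (g i) * L1_norm M2 (h i) = L1_norm (M1 \<Otimes>\<^sub>M M2) (\<lambda>z. c i * indicator (A i \<times> B i) z)"
    and ae: "\<And>i. AE z in M1 \<Otimes>\<^sub>M M2. fun_tensor (g i) (h i) z = c i * indicator (A i \<times> B i) z"
    unfolding choice_iff by blast
  have "AE z in M1 \<Otimes>\<^sub>M M2. \<forall>i. fun_tensor (g i) (h i) z = c i * indicator (A i \<times> B i) z"
    using ae by (simp add: AE_all_countable)
  then have "AE z in M1 \<Otimes>\<^sub>M M2. (\<lambda>i. fun_tensor (g i) (h i) z) sums max 0 (f z)"
    using sums by eventually_elim simp
  with gh norm[folded n] show ?thesis by (rule tensor_seriesI)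
qed

text \<open>The positive and negative parts are never nonzero together, so their norms add up to the
  norm of \<open>f\<close> and joining the two series creates no excess cost.\<close>

lemma rect_sums_tensor_series:
  assumes f: "integrable (M1 \<Otimes>\<^sub>M M2) f"
    and r: "rect_sum M1 M2 (\<lambda>z. ennreal (f z))" "rect_sum M1 M2 (\<lambda>z. ennreal (- f z))"
  shows "tensor_series M1 M2 f (L1_norm (M1 \<Otimes>\<^sub>M M2) f)"
proof -
  have f': "integrable (M1 \<Otimes>\<^sub>M M2) (\<lambda>z. - f z)" using f by simp
  have "L1_norm (M1 \<Otimes>\<^sub>M M2) f = (LINT z|(M1 \<Otimes>\<^sub>M M2). max 0 (f z) + max 0 (- f z))"
    unfolding L1_norm_def by (intro Bochner_Integration.integral_cong) auto
  also have "\<dots> = (LINT z|(M1 \<Otimes>\<^sub>M M2). max 0 (f z)) + (LINT z|(M1 \<Otimes>\<^sub>M M2). max 0 (- f z))"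
    using f by (intro Bochner_Integration.integral_add) auto
  finally have "L1_norm (M1 \<Otimes>\<^sub>M M2) f =
    (LINT z|(M1 \<Otimes>\<^sub>M M2). max 0 (f z)) + (LINT z|(M1 \<Otimes>\<^sub>M M2). max 0 (- f z))" .
  moreover have "(\<lambda>z. max 0 (f z) + - max 0 (- f z)) = f" by auto
  ultimately show ?thesis
    using tensor_series_add[OF rect_sum_tensor_series[OF r(1) f]
        tensor_series_uminus[OF rect_sum_tensor_series[OF r(2) f']]] by simp
qed

text \<open>Equality case of the triangle inequality: \<open>norm (u z)\<close> is almost everywhere
  at most the sum of the norms of the terms, and the two sides have equal integrals.\<close>

lemma norm_attaining_tensor_series:
  fixes u :: "'a \<times> 'b \<Rightarrow> 'k::{real_normed_field,banach,second_countable_topology}"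
  assumes u: "integrable (M1 \<Otimes>\<^sub>M M2) u"
    and g: "\<And>i. integrable M1 (g i)" and h: "\<And>i. integrable M2 (h i)"
    and t: "(\<lambda>i. L1_norm M1 (g i) * L1_norm M2 (h i)) sums L1_norm (M1 \<Otimes>\<^sub>M M2) u"
    and ae: "AE z in M1 \<Otimes>\<^sub>M M2. (\<lambda>i. fun_tensor (g i) (h i) z) sums u z"
  shows "AE z in M1 \<Otimes>\<^sub>M M2. (\<lambda>i. norm (fun_tensor (g i) (h i) z)) sums norm (u z)"
proof -
  let ?v = "\<lambda>i. fun_tensor (g i) (h i)"
  have s: "summable (\<lambda>i. L1_norm (M1 \<Otimes>\<^sub>M M2) (?v i))"
    using t g h by (simp add: L1_norm_fun_tensor sums_iff)
  have int: "integrable (M1 \<Otimes>\<^sub>M M2) (?v i)" for i using g h by (rule integrable_fun_tensor)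
  have "AE z in M1 \<Otimes>\<^sub>M M2. norm (u z) = (\<Sum>i. norm (?v i z))"
  proof (rule integral_ineq_eq_0_then_AE)
    show "AE z in M1 \<Otimes>\<^sub>M M2. norm (u z) \<le> (\<Sum>i. norm (?v i z))"
      using ae AE_summable_norm[OF int s]
      by eventually_elim (metis summable_norm sums_iff)
    show "(LINT z|(M1 \<Otimes>\<^sub>M M2). norm (u z)) = (LINT z|(M1 \<Otimes>\<^sub>M M2). (\<Sum>i. norm (?v i z)))"
      using integrable_sum_norm(2)[OF int s] t g h
      by (simp add: L1_norm_fun_tensor sums_iff) (simp add: L1_norm_def)
  qed (use u integrable_sum_norm(1)[OF int s] in auto)
  then show ?thesis
    using AE_summable_norm[OF int s] by eventually_elim (simp add: sums_iff)
qed

lemma norm_attaining_rect_sum: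
  assumes f: "integrable (M1 \<Otimes>\<^sub>M M2) f"
    and rep: "tensor_series M1 M2 f (L1_norm (M1 \<Otimes>\<^sub>M M2) f)"
  shows "rect_sum M1 M2 (\<lambda>z. ennreal (f z))"
proof -
  obtain g h where g: "\<And>i. integrable M1 (g i)" and h: "\<And>i. integrable M2 (h i)"
    and t: "(\<lambda>i. L1_norm M1 (g i) * L1_norm M2 (h i)) sums L1_norm (M1 \<Otimes>\<^sub>M M2) f"
    and ae: "AE z in M1 \<Otimes>\<^sub>M M2. (\<lambda>i. fun_tensor (g i) (h i) z) sums f z"
    by (rule tensor_seriesE[OF rep], rule that)
  have [measurable]: "g i \<in> borel_measurable M1" "h i \<in> borel_measurable M2" for i using g h by auto
  have "rect_sum M1 M2 (\<lambda>z. \<Sum>i. ennreal (fun_tensor (g i) (h i) z))"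
    by (intro rect_sum_suminf superlevel_rect_sum rect_union_fun_tensor) measurable
  moreover have "AE z in M1 \<Otimes>\<^sub>M M2. ennreal (f z) = (\<Sum>i. ennreal (fun_tensor (g i) (h i) z))"
    using ae norm_attaining_tensor_series[OF f g h t ae]
  proof eventually_elim
    case (elim z)
    let ?v = "\<lambda>i. fun_tensor (g i) (h i) z"
    show ?case
    proof (cases "0 \<le> f z")
      case True
      \<comment> \<open>Nonnegative terms with sum 0 all vanish, so every \<open>?v i\<close> equals
        its absolute value.\<close>
      then have *: "(\<lambda>i. \<bar>?v i\<bar> - ?v i) sums 0" using sums_diff[OF elim(2,1)] by simp
      have "\<forall>i. \<bar>?v i\<bar> - ?v i = 0"
        using sums_unique[OF *] by (subst suminf_eq_zero_iff[OF sums_summable[OF *], symmetric]) auto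
      then have "0 \<le> ?v i" for i using abs_ge_zero[of "?v i"] by (simp only: right_minus_eq)
      then show ?thesis by (rule suminf_ennreal_eq[OF _ elim(1), symmetric])
    next
      case False
      then have *: "(\<lambda>i. \<bar>?v i\<bar> + ?v i) sums 0" using sums_add[OF elim(2,1)] by simp
      have "\<forall>i. \<bar>?v i\<bar> + ?v i = 0"
        using sums_unique[OF *] by (subst suminf_eq_zero_iff[OF sums_summable[OF *], symmetric]) auto
      then have "?v i = - \<bar>?v i\<bar>" for i by (simp add: eq_neg_iff_add_eq_0 add.commute)
      then have "?v i \<le> 0" for i using abs_ge_zero[of "?v i"] by (metis neg_le_0_iff_le)
      \<comment> \<open>Here all terms and \<open>f z\<close> are nonpositive, and
        \<open>ennreal\<close> sends both sides to 0.\<close>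
      then show ?thesis using False by (simp add: ennreal_neg)
    qed
  qed
  ultimately show ?thesis by (subst rect_sum_cong)
qed

end


subsection \<open>Density of block functions\<close>

definition block_approximable :: "'a measure \<Rightarrow> 'b measure \<Rightarrow> ('a \<times> 'b \<Rightarrow> real) \<Rightarrow> bool"
  where "block_approximable M N f \<longleftrightarrow>
    (\<forall>e>0. \<exists>v. block_function M N v \<and> integrable (M \<Otimes>\<^sub>M N) v \<and>
      L1_norm (M \<Otimes>\<^sub>M N) (\<lambda>z. f z - v z) < e)"

lemma L1_norm_triangle:
  fixes f g :: "'a \<Rightarrow> 'k::{banach,second_countable_topology}"
  assumes "integrable M f" "integrable M g"
  shows "L1_norm M (\<lambda>x. f x + g x) \<le> L1_norm M f + L1_norm M g"
proof -
  have "L1_norm M (\<lambda>x. f x + g x) \<le> (LINT x|M. norm (f x) + norm (g x))"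
    unfolding L1_norm_def using assms by (intro integral_mono norm_triangle_ineq) auto
  also have "\<dots> = L1_norm M f + L1_norm M g"
    unfolding L1_norm_def using assms by (intro Bochner_Integration.integral_add) auto
  finally show ?thesis .
qed

lemma block_approximableI:
  assumes "block_function M N v" "integrable (M \<Otimes>\<^sub>M N) v"
  shows "block_approximable M N v"
  unfolding block_approximable_def using assms by (auto intro!: exI[of _ v])

lemma block_approximable_lim:
  assumes f: "integrable (M \<Otimes>\<^sub>M N) f"
    and g: "\<And>e. 0 < e \<Longrightarrow> \<exists>g. block_approximable M N g \<and> integrable (M \<Otimes>\<^sub>M N) g \<and>
      L1_norm (M \<Otimes>\<^sub>M N) (\<lambda>z. f z - g z) < e"
  shows "block_approximable M N f"
  unfolding block_approximable_def
proof (intro allI impI)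
  fix e :: real assume "0 < e"
  then have e: "0 < e / 2" by simp
  from g[OF e] obtain g where g: "block_approximable M N g" "integrable (M \<Otimes>\<^sub>M N) g"
    "L1_norm (M \<Otimes>\<^sub>M N) (\<lambda>z. f z - g z) < e / 2" by (elim exE conjE)
  obtain v where v: "block_function M N v" "integrable (M \<Otimes>\<^sub>M N) v"
    "L1_norm (M \<Otimes>\<^sub>M N) (\<lambda>z. g z - v z) < e / 2"
    using g(1)[unfolded block_approximable_def, rule_format, OF e] by (elim exE conjE)
  have "L1_norm (M \<Otimes>\<^sub>M N) (\<lambda>z. f z - v z) \<le>
      L1_norm (M \<Otimes>\<^sub>M N) (\<lambda>z. f z - g z) + L1_norm (M \<Otimes>\<^sub>M N) (\<lambda>z. g z - v z)"
    using L1_norm_triangle[of "M \<Otimes>\<^sub>M N" "\<lambda>z. f z - g z" "\<lambda>z. g z - v z"] f g(2) v(2) by simp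
  then show "\<exists>v. block_function M N v \<and> integrable (M \<Otimes>\<^sub>M N) v \<and>
      L1_norm (M \<Otimes>\<^sub>M N) (\<lambda>z. f z - v z) < e"
    using g(3) v by (intro exI[of _ v]) simp
qed

text \<open>Serves three limits: countable disjoint unions, the exhaustion of the space by sets of
  finite measure, and the approximation of integrable functions by simple ones.\<close>

lemma block_approximable_dominated:
  fixes s :: "nat \<Rightarrow> 'a \<times> 'b \<Rightarrow> real"
  assumes s: "\<And>n. block_approximable M N (s n)" "\<And>n. integrable (M \<Otimes>\<^sub>M N) (s n)"
    and w: "integrable (M \<Otimes>\<^sub>M N) w" "\<And>n z. z \<in> space (M \<Otimes>\<^sub>M N) \<Longrightarrow> \<bar>s n z\<bar> \<le> w z"
    and f: "integrable (M \<Otimes>\<^sub>M N) f" "\<And>z. z \<in> space (M \<Otimes>\<^sub>M N) \<Longrightarrow> (\<lambda>n. s n z) \<longlonglongrightarrow> f z"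
  shows "block_approximable M N f"
proof (rule block_approximable_lim[OF f(1)])
  fix e :: real assume e: "0 < e"
  have [measurable]: "f \<in> borel_measurable (M \<Otimes>\<^sub>M N)" "s n \<in> borel_measurable (M \<Otimes>\<^sub>M N)" for n
    using s f by auto
  have "(\<lambda>n. LINT z|(M \<Otimes>\<^sub>M N). norm (f z - s n z)) \<longlonglongrightarrow> (LINT z|(M \<Otimes>\<^sub>M N). 0)"
  proof (rule integral_dominated_convergence)
    show "integrable (M \<Otimes>\<^sub>M N) (\<lambda>z. \<bar>f z\<bar> + w z)" using f w by auto
    show "AE z in M \<Otimes>\<^sub>M N. (\<lambda>n. norm (f z - s n z)) \<longlonglongrightarrow> 0"
    proof (rule AE_I2)
      fix z assume "z \<in> space (M \<Otimes>\<^sub>M N)"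
      from tendsto_norm[OF tendsto_diff[OF tendsto_const[of "f z"] f(2)[OF this]]]
      show "(\<lambda>n. norm (f z - s n z)) \<longlonglongrightarrow> 0" by simp
    qed
    show "AE z in M \<Otimes>\<^sub>M N. norm (norm (f z - s n z)) \<le> \<bar>f z\<bar> + w z" for n
    proof (rule AE_I2)
      fix z assume "z \<in> space (M \<Otimes>\<^sub>M N)"
      from w(2)[OF this, of n] show "norm (norm (f z - s n z)) \<le> \<bar>f z\<bar> + w z" by simp
    qed
  qed auto
  then have "(\<lambda>n. L1_norm (M \<Otimes>\<^sub>M N) (\<lambda>z. f z - s n z)) \<longlonglongrightarrow> 0" by (simp add: L1_norm_def)
  from order_tendstoD(2)[OF this e] obtain n where "L1_norm (M \<Otimes>\<^sub>M N) (\<lambda>z. f z - s n z) < e"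
    by (auto simp: eventually_sequentially)
  then show "\<exists>g. block_approximable M N g \<and> integrable (M \<Otimes>\<^sub>M N) g \<and>
      L1_norm (M \<Otimes>\<^sub>M N) (\<lambda>z. f z - g z) < e"
    using s by (intro exI[of _ "s n"]) simp
qed

lemma block_approximable_add:
  assumes f: "block_approximable M N f" "integrable (M \<Otimes>\<^sub>M N) f"
    and g: "block_approximable M N g" "integrable (M \<Otimes>\<^sub>M N) g"
  shows "block_approximable M N (\<lambda>z. f z + g z)"
  unfolding block_approximable_def
proof (intro allI impI)
  fix e :: real assume "0 < e"
  then have e: "0 < e / 2" by simp
  obtain v where v: "block_function M N v" "integrable (M \<Otimes>\<^sub>M N) v"
    "L1_norm (M \<Otimes>\<^sub>M N) (\<lambda>z. f z - v z) < e / 2"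
    using f(1)[unfolded block_approximable_def, rule_format, OF e] by (elim exE conjE)
  obtain w where w: "block_function M N w" "integrable (M \<Otimes>\<^sub>M N) w"
    "L1_norm (M \<Otimes>\<^sub>M N) (\<lambda>z. g z - w z) < e / 2"
    using g(1)[unfolded block_approximable_def, rule_format, OF e] by (elim exE conjE)
  have eq: "(\<lambda>z. f z + g z - (v z + w z)) = (\<lambda>z. (f z - v z) + (g z - w z))" by auto
  have "L1_norm (M \<Otimes>\<^sub>M N) (\<lambda>z. f z + g z - (v z + w z)) \<le>
      L1_norm (M \<Otimes>\<^sub>M N) (\<lambda>z. f z - v z) + L1_norm (M \<Otimes>\<^sub>M N) (\<lambda>z. g z - w z)"
    unfolding eq using f g v w by (intro L1_norm_triangle) auto
  then show "\<exists>v. block_function M N v \<and> integrable (M \<Otimes>\<^sub>M N) v \<and>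
      L1_norm (M \<Otimes>\<^sub>M N) (\<lambda>z. f z + g z - v z) < e"
    using v w block_function_comp2[OF v(1) w(1), of "(+)"]
    by (intro exI[of _ "\<lambda>z. v z + w z"]) simp
qed

lemma block_approximable_cmult:
  assumes f: "block_approximable M N f" "integrable (M \<Otimes>\<^sub>M N) f"
  shows "block_approximable M N (\<lambda>z. c * f z)"
  unfolding block_approximable_def
proof (intro allI impI)
  fix e :: real assume "0 < e"
  then have e: "0 < e / (\<bar>c\<bar> + 1)" by simp
  obtain v where v: "block_function M N v" "integrable (M \<Otimes>\<^sub>M N) v"
    "L1_norm (M \<Otimes>\<^sub>M N) (\<lambda>z. f z - v z) < e / (\<bar>c\<bar> + 1)"
    using f(1)[unfolded block_approximable_def, rule_format, OF e] by (elim exE conjE)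
  have "L1_norm (M \<Otimes>\<^sub>M N) (\<lambda>z. c * f z - c * v z) = \<bar>c\<bar> * L1_norm (M \<Otimes>\<^sub>M N) (\<lambda>z. f z - v z)"
    by (simp add: L1_norm_def abs_mult flip: right_diff_distrib)
  also have "\<dots> \<le> (\<bar>c\<bar> + 1) * L1_norm (M \<Otimes>\<^sub>M N) (\<lambda>z. f z - v z)"
    by (intro mult_right_mono) auto
  also have "\<dots> < e" using v(3) by (subst (asm) pos_less_divide_eq) (auto simp: mult.commute)
  finally show "\<exists>v. block_function M N v \<and> integrable (M \<Otimes>\<^sub>M N) v \<and>
      L1_norm (M \<Otimes>\<^sub>M N) (\<lambda>z. c * f z - v z) < e"
    using v block_function_comp2[OF v(1) v(1), of "\<lambda>a b. c * a"]
    by (intro exI[of _ "\<lambda>z. c * v z"]) simp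
qed

lemma block_approximable_sum:
  assumes "\<And>i. block_approximable M N (s i)" "\<And>i. integrable (M \<Otimes>\<^sub>M N) (s i)"
  shows "block_approximable M N (\<lambda>z. \<Sum>i<(n::nat). s i z)"
proof (induction n)
  case 0
  then show ?case using block_approximableI[OF block_function_const[of M N 0]] by simp
next
  case (Suc n)
  then show ?case using block_approximable_add[OF Suc] assms by simp
qed

lemma integrable_indicator_subset:
  assumes "E \<in> sets M" "E \<subseteq> F" "emeasure M F < \<infinity>" "F \<in> sets M"
  shows "integrable M (indicator E :: _ \<Rightarrow> real)"
  using assms emeasure_mono[OF assms(2,4)] by (intro integrable_real_indicator) (auto simp: top_unique less_top)

context pair_sigma_finite
begin

text \<open>Dynkin argument over the rectangles. It is run for all truncations to the finite-measure
  rectangles \<open>F n\<close> of an exhaustion, so that complements and unions stay integrable;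
  dominated convergence then removes the truncation.\<close>

lemma block_approximable_indicator:
  assumes E: "E \<in> sets (M1 \<Otimes>\<^sub>M M2)" "emeasure (M1 \<Otimes>\<^sub>M M2) E < \<infinity>"
  shows "block_approximable M1 M2 (indicator E)"
proof -
  let ?P = "M1 \<Otimes>\<^sub>M M2" and ?G = "{A \<times> B | A B. A \<in> sets M1 \<and> B \<in> sets M2}"
  obtain F :: "nat \<Rightarrow> ('a \<times> 'b) set" where F: "range F \<subseteq> ?G" "incseq F"
    "(\<Union>i. F i) = space M1 \<times> space M2" "\<And>i. emeasure ?P (F i) \<noteq> \<infinity>"
    using sigma_finite_up_in_pair_measure_generator by auto
  have FG: "F n \<in> ?G" for n by (rule subsetD[OF F(1)]) simp
  have F_sets: "F n \<in> sets ?P" for n using FG[of n] by auto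
  have int: "integrable ?P (indicator (D \<inter> F n) :: _ \<Rightarrow> real)" if "D \<in> sets ?P" for D n
    using that F(4)[of n] F_sets[of n]
    by (intro integrable_indicator_subset[of _ _ "F n"]) (auto simp: less_top)
  have "E \<in> sigma_sets (space M1 \<times> space M2) ?G" using E by (simp add: sets_pair_measure)
  with Int_stable_pair_measure_generator pair_measure_closed
  have "\<forall>n. block_approximable M1 M2 (indicator (E \<inter> F n))"
  proof (induction rule: sigma_sets_induct_disjoint)
    case (basic D)
    show ?case
    proof
      fix n
      obtain A B where "A \<in> sets M1" "B \<in> sets M2" "F n = A \<times> B" using FG[of n] by auto
      moreover obtain A' B' where "A' \<in> sets M1" "B' \<in> sets M2" "D = A' \<times> B'" using basic by auto
      ultimately obtain A B where AB: "A \<in> sets M1" "B \<in> sets M2" "D \<inter> F n = A \<times> B"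
        using Times_Int_Times sets.Int by metis
      then have "block_function M1 M2 (indicator (D \<inter> F n) :: _ \<Rightarrow> real)"
        by (simp add: block_function_rect)
      moreover have "D \<in> sets ?P" using basic by auto
      ultimately show "block_approximable M1 M2 (indicator (D \<inter> F n))"
        using int by (intro block_approximableI)
    qed
  next
    case empty
    then show ?case using block_approximableI[OF block_function_const[of M1 M2 0]]
      by (simp add: indicator_def[abs_def])
  next
    case (compl D)
    show ?case
    proof
      fix n
      have D: "D \<in> sets ?P" using compl(1) by (simp add: sets_pair_measure)
      have "F n \<subseteq> space M1 \<times> space M2" using F(3) by blast
      then have eq: "indicator ((space M1 \<times> space M2 - D) \<inter> F n) =
          (\<lambda>z. indicator (space ?P \<inter> F n) z + (-1) * indicator (D \<inter> F n) z :: real)"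
        by (auto simp: fun_eq_iff indicator_def space_pair_measure)
      have "F n \<in> ?G" by (rule FG)
      then have "block_function M1 M2 (indicator (space ?P \<inter> F n) :: _ \<Rightarrow> real)"
        using \<open>F n \<subseteq> _\<close> by (auto simp: space_pair_measure Int_absorb1 intro!: block_function_rect)
      then have "block_approximable M1 M2 (indicator (space ?P \<inter> F n))"
        using int by (intro block_approximableI) auto
      then show "block_approximable M1 M2 (indicator ((space M1 \<times> space M2 - D) \<inter> F n))"
        unfolding eq using int[OF D, of n] compl(2) int[of "space ?P" n]
        by (intro block_approximable_add block_approximable_cmult) auto
    qed
  next
    case (union A)
    have A: "A i \<in> sets ?P" for i using union(2) by (auto simp: sets_pair_measure)
    show ?case
    proof
      fix n
      \<comment> \<open>Disjointness makes the partial sums indicators again, whence the indicator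
        of the whole truncated union dominates them.\<close>
      have sum: "(\<Sum>i<m. indicator (A i \<inter> F n) z) = (indicator ((\<Union>i<m. A i) \<inter> F n) z :: real)" for m z
      proof -
        have "(\<Sum>i<m. indicator (A i \<inter> F n) z :: real) = indicator (\<Union>i<m. A i \<inter> F n) z"
          using union(1) by (intro indicator_UN_disjoint[symmetric])
            (auto simp: disjoint_family_on_def)
        then show ?thesis by (simp add: Int_UN_distrib2 Int_commute)
      qed
      show "block_approximable M1 M2 (indicator (\<Union> (range A) \<inter> F n))"
      proof (rule block_approximable_dominated)
        show "block_approximable M1 M2 (\<lambda>z. \<Sum>i<m. indicator (A i \<inter> F n) z)" for m
          using union(3) int[OF A] by (intro block_approximable_sum) auto
        show "integrable ?P (\<lambda>z. \<Sum>i<m. indicator (A i \<inter> F n) z :: real)" for m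
          using int[OF A] by (intro Bochner_Integration.integrable_sum)
        \<comment> \<open>One function is both the dominating function and the limit, so its
          integrability is asked for twice.\<close>
        show "integrable ?P (indicator (\<Union> (range A) \<inter> F n) :: _ \<Rightarrow> real)"
          using A by (intro int) auto
        then show "integrable ?P (indicator (\<Union> (range A) \<inter> F n) :: _ \<Rightarrow> real)" .
        show "\<bar>\<Sum>i<m. indicator (A i \<inter> F n) z\<bar> \<le> (indicator (\<Union> (range A) \<inter> F n) z :: real)" for m z
          unfolding sum by (auto simp: indicator_def)
        show "(\<lambda>m. \<Sum>i<m. indicator (A i \<inter> F n) z) \<longlonglongrightarrow> (indicator (\<Union> (range A) \<inter> F n) z :: real)" for z
        proof (cases "\<exists>i. z \<in> A i \<inter> F n")
          case True
          then obtain i where i: "z \<in> A i \<inter> F n" ..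
          have "eventually (\<lambda>m. (\<Sum>i<m. indicator (A i \<inter> F n) z) = (indicator (\<Union> (range A) \<inter> F n) z :: real)) sequentially"
            using eventually_gt_at_top[of i]
            by eventually_elim (unfold sum, use i in \<open>auto simp: indicator_def\<close>)
          then show ?thesis by (rule tendsto_eventually)
        next
          case False
          then show ?thesis unfolding sum by (auto simp: indicator_def)
        qed
      qed
    qed
  qed
  then have approx: "block_approximable M1 M2 (indicator (E \<inter> F n))" for n by simp
  show ?thesis
  proof (rule block_approximable_dominated)
    show "block_approximable M1 M2 (indicator (E \<inter> F n))" for n by (rule approx)
    show "integrable ?P (indicator (E \<inter> F n) :: _ \<Rightarrow> real)" for n by (rule int[OF E(1)])
    show "integrable ?P (indicator E :: _ \<Rightarrow> real)" using E by (intro integrable_real_indicator)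
    then show "integrable ?P (indicator E :: _ \<Rightarrow> real)" .
    show "\<bar>indicator (E \<inter> F n) z\<bar> \<le> (indicator E z :: real)" for n z by (auto simp: indicator_def)
    fix z assume "z \<in> space ?P"
    then have "z \<in> (\<Union>i. F i)" using F(3) by (simp add: space_pair_measure)
    then obtain i where i: "z \<in> F i" by blast
    have "eventually (\<lambda>n. indicator (E \<inter> F n) z = (indicator E z :: real)) sequentially"
      using eventually_ge_at_top[of i]
    proof eventually_elim
      case (elim n)
      then have "z \<in> F n" using i F(2) by (auto dest: incseqD)
      then show ?case by (simp add: indicator_def)
    qed
    then show "(\<lambda>n. indicator (E \<inter> F n) z) \<longlonglongrightarrow> (indicator E z :: real)" by (rule tendsto_eventually)
  qed
qed

lemma block_approximable_integrable:
  assumes "integrable (M1 \<Otimes>\<^sub>M M2) f"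
  shows "block_approximable M1 M2 f"
  using assms
proof (induction rule: integrable_induct)
  case (base A c)
  then have "block_approximable M1 M2 (\<lambda>z. c * indicator A z)"
    by (intro block_approximable_cmult block_approximable_indicator integrable_real_indicator)
  then show ?case by (simp add: mult.commute)
next
  case (add f g)
  then show ?case by (intro block_approximable_add)
next
  case (lim f s)
  show ?case
  \<comment> \<open>The factor 2 is the bound on the simple functions that
    \<open>integrable_induct\<close> provides.\<close>
  proof (rule block_approximable_dominated[of M1 M2 s "\<lambda>z. 2 * \<bar>f z\<bar>"])
    show "integrable (M1 \<Otimes>\<^sub>M M2) (\<lambda>z. 2 * \<bar>f z\<bar>)" using lim(4) by (intro integrable_mult_right integrable_abs)
    show "\<bar>s n z\<bar> \<le> 2 * \<bar>f z\<bar>" if "z \<in> space (M1 \<Otimes>\<^sub>M M2)" for n z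
      using lim(3)[OF that] by simp
  qed (fact lim)+
qed

text \<open>Both parts of a block function are nonnegative block functions, hence disjoint rectangle
  sums. They enter as \<open>max 0 (v z)\<close> and \<open>max 0 (- v z)\<close>, which
  \<open>ennreal\<close> identifies with \<open>v z\<close> and \<open>- v z\<close>.\<close>

lemma block_function_tensor_series:
  fixes v :: "'a \<times> 'b \<Rightarrow> real"
  assumes v: "block_function M1 M2 v" "integrable (M1 \<Otimes>\<^sub>M M2) v"
  shows "tensor_series M1 M2 v (L1_norm (M1 \<Otimes>\<^sub>M M2) v)"
proof (rule rect_sums_tensor_series[OF v(2)])
  have "rect_sum M1 M2 (\<lambda>z. ennreal (max 0 (v z)))"
    by (intro block_function_rect_sum block_function_comp2[OF v(1) v(1), of "\<lambda>a b. max 0 a"]) simp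
  then show "rect_sum M1 M2 (\<lambda>z. ennreal (v z))" by (simp add: ennreal_max_0 max.commute)
  have "rect_sum M1 M2 (\<lambda>z. ennreal (max 0 (- v z)))"
    by (intro block_function_rect_sum block_function_comp2[OF v(1) v(1), of "\<lambda>a b. max 0 (- a)"]) simp
  then show "rect_sum M1 M2 (\<lambda>z. ennreal (- v z))" by (simp add: ennreal_max_0 max.commute)
qed

text \<open>Block functions \<open>w n\<close> approximate \<open>f\<close> with errors below
  \<open>d n\<close>, and their increments \<open>v n\<close> have cost exactly their norm. The
  excess comes from the errors alone: \<open>v 0\<close> costs at most
  \<open>L1_norm ?P f + d 0\<close>, and \<open>v (Suc n)\<close> at most
  \<open>2 * d n\<close>.\<close>

lemma tensor_series_le_L1_norm_add:
  fixes f :: "'a \<times> 'b \<Rightarrow> real"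
  assumes f: "integrable (M1 \<Otimes>\<^sub>M M2) f" and e: "0 < e"
  shows "\<exists>t. tensor_series M1 M2 f t \<and> t \<le> L1_norm (M1 \<Otimes>\<^sub>M M2) f + e"
proof -
  let ?P = "M1 \<Otimes>\<^sub>M M2"
  \<comment> \<open>The later increments then cost at most \<open>e / 2\<close> in total, and
    \<open>d 0 = e / 8\<close>, which leaves the excess below \<open>e\<close>.\<close>
  define d where "d n = e / 8 * (1 / 2) ^ n" for n :: nat
  have d: "0 < d n" for n using e by (simp add: d_def)
  have "\<forall>n. \<exists>v. block_function M1 M2 v \<and> integrable ?P v \<and> L1_norm ?P (\<lambda>z. f z - v z) < d n"
    using block_approximable_integrable[OF f, unfolded block_approximable_def] d by (intro allI) (elim allE impE)
  then obtain w where W: "\<forall>n. block_function M1 M2 (w n) \<and> integrable ?P (w n) \<and>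
      L1_norm ?P (\<lambda>z. f z - w n z) < d n"
    unfolding choice_iff ..
  then have w: "block_function M1 M2 (w n)" "integrable ?P (w n)"
    and wn: "L1_norm ?P (\<lambda>z. f z - w n z) < d n" for n by simp_all
  define v where "v n z = (case n of 0 \<Rightarrow> w 0 z | Suc m \<Rightarrow> w (Suc m) z - w m z)" for n z
  have v_0: "v 0 = w 0" and v_Suc: "v (Suc m) = (\<lambda>z. w (Suc m) z - w m z)" for m
    by (simp_all add: v_def fun_eq_iff)
  have v: "block_function M1 M2 (v n)" "integrable ?P (v n)" for n
    by (cases n; use w block_function_comp2[OF w(1) w(1), of "(-)"] in \<open>simp add: v_0 v_Suc\<close>)+
  have sum_v: "(\<Sum>i<Suc n. v i z) = w n z" for n z
    by (induction n) (simp_all add: v_0 v_Suc)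
  have L_0: "L1_norm ?P (v 0) \<le> L1_norm ?P f + d 0"
    using L1_norm_triangle[of ?P f "\<lambda>z. - (f z - w 0 z)"] f w(2) wn[of 0]
    by (simp add: v_0 L1_norm_uminus[of ?P "\<lambda>z. f z - w 0 z", simplified])
  have L_Suc: "L1_norm ?P (v (Suc n)) \<le> 2 * d n" for n
  proof -
    have eq: "v (Suc n) = (\<lambda>z. (f z - w n z) + - (f z - w (Suc n) z))" by (auto simp: v_Suc)
    have "L1_norm ?P (v (Suc n)) \<le>
        L1_norm ?P (\<lambda>z. f z - w n z) + L1_norm ?P (\<lambda>z. - (f z - w (Suc n) z))"
      unfolding eq using f w(2) by (intro L1_norm_triangle) auto
    also have "\<dots> \<le> d n + d (Suc n)"
      using wn[of n] wn[of "Suc n"] by (simp only: L1_norm_uminus)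
    also have "d (Suc n) \<le> d n" using e by (simp add: d_def)
    finally show ?thesis by simp
  qed
  have "(\<lambda>n. 2 * d n) sums (2 * (e / 8 * (1 / (1 - 1 / 2))))"
    unfolding d_def by (intro sums_mult geometric_sums) simp
  then have sd: "(\<lambda>n. 2 * d n) sums (e / 2)" by simp
  have s': "summable (\<lambda>n. L1_norm ?P (v (Suc n)))"
    using L_Suc by (intro summable_comparison_test'[OF sums_summable[OF sd], of 0]) auto
  then have s: "summable (\<lambda>n. L1_norm ?P (v n))" by (subst (asm) summable_Suc_iff)
  define t where "t = (\<Sum>n. L1_norm ?P (v n))"
  have "t = (\<Sum>n. L1_norm ?P (v (Suc n))) + L1_norm ?P (v 0)"
    unfolding t_def using suminf_split_head[OF s] by simp
  also have "(\<Sum>n. L1_norm ?P (v (Suc n))) \<le> (\<Sum>n. 2 * d n)"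
    using L_Suc by (intro suminf_le s' sums_summable[OF sd])
  also have "\<dots> = e / 2" using sd by (simp add: sums_iff)
  finally have t_le: "t \<le> L1_norm ?P f + (e / 2 + d 0)" using L_0 by simp
  have "L1_sums ?P v f"
    unfolding L1_sums_def
  proof (intro conjI allI)
    have "(\<lambda>n. 2 * d n / 2) \<longlonglongrightarrow> 0 / 2"
      by (intro tendsto_divide summable_LIMSEQ_zero[OF sums_summable[OF sd]] tendsto_const) simp
    then have "d \<longlonglongrightarrow> 0" by simp
    have bound: "norm (L1_norm ?P (\<lambda>z. (\<Sum>i<Suc n. v i z) - f z)) \<le> d n" for n
    proof -
      have "(\<lambda>z. w n z - f z) = (\<lambda>z. - (f z - w n z))" by auto
      then have "L1_norm ?P (\<lambda>z. w n z - f z) = L1_norm ?P (\<lambda>z. f z - w n z)"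
        by (simp only: L1_norm_uminus)
      then show ?thesis unfolding sum_v using wn[of n] by simp
    qed
    \<comment> \<open>The increments telescope to \<open>w n\<close> after \<open>Suc n\<close>
      terms, so the limit is taken along the shifted sequence.\<close>
    have "(\<lambda>n. L1_norm ?P (\<lambda>z. (\<Sum>i<Suc n. v i z) - f z)) \<longlonglongrightarrow> 0"
      by (rule Lim_null_comparison[OF always_eventually[OF allI[OF bound]] \<open>d \<longlonglongrightarrow> 0\<close>])
    then show "(\<lambda>n. L1_norm ?P (\<lambda>z. (\<Sum>i<n. v i z) - f z)) \<longlonglongrightarrow> 0"
      by (rule LIMSEQ_imp_Suc)
  qed (fact v f)+
  then have ae: "AE z in ?P. (\<lambda>n. v n z) sums f z" by (rule L1_sums_iff[OF v(2) s f, THEN iffD1])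
  have "(\<lambda>n. L1_norm ?P (v n)) sums t" unfolding t_def using s by (rule summable_sums)
  from tensor_series_suminf[OF block_function_tensor_series[OF v] this ae]
  have "tensor_series M1 M2 f t" .
  moreover have "e / 2 + d 0 \<le> e" using e by (simp add: d_def)
  ultimately show ?thesis using t_le by (intro exI[of _ t]) simp
qed

end


subsection \<open>The projective norm\<close>

context pair_sigma_finite
begin

text \<open>The hypothesis \<open>approx\<close> isolates the upper bound, which is proved for real
  functions and then carried over to their complex embeddings; the rest of the argument is the same
  for every scalar field.\<close>

lemma proj_norm_eq_L1_norm:
  fixes u :: "'a \<times> 'b \<Rightarrow> 'k::{real_normed_field,banach,second_countable_topology}"
  assumes u: "integrable (M1 \<Otimes>\<^sub>M M2) u"
    and approx: "\<And>e. 0 < e \<Longrightarrow> \<exists>t. tensor_series M1 M2 u t \<and> t \<le> L1_norm (M1 \<Otimes>\<^sub>M M2) u + e"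
  shows "proj_norm M1 M2 u = L1_norm (M1 \<Otimes>\<^sub>M M2) u"
proof -
  have "{\<Sum>i. L1_norm M1 (g i) * L1_norm M2 (h i) | g h. proj_representation M1 M2 g h u} =
      {t. tensor_series M1 M2 u t}"
    unfolding tensor_series_iff[OF u] by auto
  then have eq: "proj_norm M1 M2 u = Inf {t. tensor_series M1 M2 u t}"
    by (simp add: proj_norm_def)
  have lower: "L1_norm (M1 \<Otimes>\<^sub>M M2) u \<le> t" if "tensor_series M1 M2 u t" for t
    by (rule L1_norm_le_tensor_series[OF u that])
  show ?thesis
  proof (rule antisym)
    show "proj_norm M1 M2 u \<le> L1_norm (M1 \<Otimes>\<^sub>M M2) u"
    proof (rule field_le_epsilon)
      fix e :: real assume "0 < e"
      then obtain t where t: "tensor_series M1 M2 u t" "t \<le> L1_norm (M1 \<Otimes>\<^sub>M M2) u + e"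
        using approx[of e] by auto
      have "Inf {t. tensor_series M1 M2 u t} \<le> t"
        using t(1) lower by (intro cInf_lower bdd_belowI) auto
      with t(2) show "proj_norm M1 M2 u \<le> L1_norm (M1 \<Otimes>\<^sub>M M2) u + e" unfolding eq by simp
    qed
    show "L1_norm (M1 \<Otimes>\<^sub>M M2) u \<le> proj_norm M1 M2 u"
      \<comment> \<open>\<open>approx[of 1]\<close> shows that the set of costs is nonempty, as
        \<open>cInf_greatest\<close> requires.\<close>
      unfolding eq using approx[of 1] lower by (intro cInf_greatest) auto
  qed
qed

lemma NA_proj_iff_tensor_series:
  fixes u :: "'a \<times> 'b \<Rightarrow> 'k::{real_normed_field,banach,second_countable_topology}"
  assumes u: "integrable (M1 \<Otimes>\<^sub>M M2) u"
    and approx: "\<And>e. 0 < e \<Longrightarrow> \<exists>t. tensor_series M1 M2 u t \<and> t \<le> L1_norm (M1 \<Otimes>\<^sub>M M2) u + e"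
  shows "u \<in> NA_proj M1 M2 \<longleftrightarrow> tensor_series M1 M2 u (L1_norm (M1 \<Otimes>\<^sub>M M2) u)"
  unfolding NA_proj_def tensor_series_iff[OF u] using proj_norm_eq_L1_norm[OF u approx] by simp

section \<open>Passage between real and complex scalars\<close>

lemma tensor_series_complex_of_real:
  assumes "tensor_series M1 M2 f t"
  shows "tensor_series M1 M2 (\<lambda>z. complex_of_real (f z)) t"
proof -
  obtain g h where gh: "\<And>i. integrable M1 (g i)" "\<And>i. integrable M2 (h i)"
    "(\<lambda>i. L1_norm M1 (g i) * L1_norm M2 (h i)) sums t"
    and ae: "AE z in M1 \<Otimes>\<^sub>M M2. (\<lambda>i. fun_tensor (g i) (h i) z) sums f z"
    by (rule tensor_seriesE[OF assms], rule that)
  have eq: "fun_tensor (\<lambda>x. complex_of_real (g i x)) (\<lambda>y. complex_of_real (h i y)) z =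
      complex_of_real (fun_tensor (g i) (h i) z)" for i z
    by (simp add: fun_tensor_def split_beta)
  show ?thesis
  proof (rule tensor_seriesI)
    show "AE z in M1 \<Otimes>\<^sub>M M2. (\<lambda>i. fun_tensor (\<lambda>x. complex_of_real (g i x)) (\<lambda>y. complex_of_real (h i y)) z)
        sums complex_of_real (f z)"
      using ae by eventually_elim (simp only: eq sums_of_real)
  qed (use gh in \<open>auto simp: L1_norm_def\<close>)
qed

lemma AE_pair_snd:
  assumes "AE y in M2. Q y"
  shows "AE z in M1 \<Otimes>\<^sub>M M2. Q (snd z)"
proof -
  obtain S where S: "S \<in> null_sets M2" "{y \<in> space M2. \<not> Q y} \<subseteq> S"
    using assms by (auto simp: eventually_ae_filter)
  then have "space M1 \<times> S \<in> null_sets (M1 \<Otimes>\<^sub>M M2)" by auto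
  from AE_not_in[OF this] AE_space show ?thesis
    by eventually_elim (use S(2) in \<open>auto simp: space_pair_measure\<close>)
qed

lemma AE_pair_fst:
  assumes "AE x in M1. Q x"
  shows "AE z in M1 \<Otimes>\<^sub>M M2. Q (fst z)"
proof -
  obtain S where S: "S \<in> null_sets M1" "{x \<in> space M1. \<not> Q x} \<subseteq> S"
    using assms by (auto simp: eventually_ae_filter)
  then have "S \<times> space M2 \<in> null_sets (M1 \<Otimes>\<^sub>M M2)" by auto
  from AE_not_in[OF this] AE_space show ?thesis
    by eventually_elim (use S(2) in \<open>auto simp: space_pair_measure\<close>)
qed

text \<open>
  If \<open>g x \<cdot> h y\<close> is almost everywhere real, then multiplying \<open>h\<close> by the phase of \<open>g x\<^sub>0\<close>, for a
  suitable \<open>x\<^sub>0\<close>, and \<open>g\<close> by its inverse makes \<open>h\<close> real.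
\<close>

lemma real_fun_tensor:
  fixes g :: "'a \<Rightarrow> complex" and h :: "'b \<Rightarrow> complex"
  assumes g: "integrable M1 g" and h: "integrable M2 h"
    and im: "AE z in M1 \<Otimes>\<^sub>M M2. Im (fun_tensor g h z) = 0"
  shows "\<exists>g' h'. integrable M1 g' \<and> integrable M2 h' \<and>
    L1_norm M1 g' * L1_norm M2 h' \<le> L1_norm M1 g * L1_norm M2 h \<and>
    (AE z in M1 \<Otimes>\<^sub>M M2. fun_tensor g' h' z = Re (fun_tensor g h z))"
proof (cases "AE x in M1. g x = 0")
  case True
  from AE_pair_fst[OF this] have "AE z in M1 \<Otimes>\<^sub>M M2. fun_tensor (\<lambda>_. 0) (\<lambda>_. 0) z = Re (fun_tensor g h z)"
    by eventually_elim (simp add: fun_tensor_def split_beta)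
  then show ?thesis by (intro exI[of _ "\<lambda>_. 0"] conjI) simp_all
next
  case False
  \<comment> \<open>For almost every \<open>x\<close> the section of the product is real almost
    everywhere; since \<open>g\<close> is not zero almost everywhere, some such \<open>x\<close> has
    \<open>g x \<noteq> 0\<close>.\<close>
  have "\<exists>x. g x \<noteq> 0 \<and> (AE y in M2. Im (fun_tensor g h (x, y)) = 0)"
  proof (rule ccontr)
    assume *: "\<not> ?thesis"
    from AE_pair[OF im] have "AE x in M1. g x = 0"
      by (rule eventually_mono) (use * in blast)
    with False show False by simp
  qed
  then obtain x where x: "g x \<noteq> 0" and ae: "AE y in M2. Im (fun_tensor g h (x, y)) = 0" by blast
  define s where "s = sgn (g x)"
  have "norm s = 1" using x by (simp add: s_def norm_sgn)
  have gx: "g x = complex_of_real (cmod (g x)) * s" using x by (simp add: s_def sgn_eq)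
  from \<open>norm s = 1\<close> have s: "norm s = 1" "cnj s * s = 1"
    using complex_norm_square[of s] by (simp_all add: mult.commute)
  \<comment> \<open>Since \<open>s * h y\<close> turns out to be real almost everywhere, the real
    part of the product is the product of the real parts. Taking real parts does not increase the
    norms, and the phases have modulus 1.\<close>
  define G where "G x = Re (g x * cnj s)" for x
  define H where "H y = Re (s * h y)" for y
  have int: "integrable M1 G" "integrable M2 H"
    unfolding G_def H_def using g h by (auto intro!: integrable_bounded_linear[OF bounded_linear_Re])
  have "L1_norm M1 G \<le> L1_norm M1 g"
    unfolding L1_norm_def
  proof (intro integral_mono)
    show "norm (G x) \<le> norm (g x)" for x
      using abs_Re_le_cmod[of "g x * cnj s"] s by (simp add: G_def norm_mult)
  qed (use int g in auto)
  moreover have "L1_norm M2 H \<le> L1_norm M2 h"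
    unfolding L1_norm_def
  proof (intro integral_mono)
    show "norm (H y) \<le> norm (h y)" for y
      using abs_Re_le_cmod[of "s * h y"] s by (simp add: H_def norm_mult)
  qed (use int h in auto)
  ultimately have le: "L1_norm M1 G * L1_norm M2 H \<le> L1_norm M1 g * L1_norm M2 h"
    by (intro mult_mono) auto
  have "AE y in M2. Im (s * h y) = 0"
    using ae
  proof eventually_elim
    case (elim y)
    have "g x * h y = complex_of_real (cmod (g x)) * (s * h y)" by (subst gx) (simp only: mult.assoc)
    moreover have "Im (complex_of_real r * c) = r * Im c" for r c by simp
    ultimately have "Im (g x * h y) = cmod (g x) * Im (s * h y)" by (simp only:)
    then show ?case using elim x by (simp add: fun_tensor_def)
  qed
  from AE_pair_snd[OF this] have "AE z in M1 \<Otimes>\<^sub>M M2. fun_tensor G H z = Re (fun_tensor g h z)"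
  proof eventually_elim
    case (elim z)
    have "fun_tensor g h z = (cnj s * s) * (g (fst z) * h (snd z))"
      unfolding s by (simp add: fun_tensor_def split_beta)
    also have "\<dots> = (g (fst z) * cnj s) * (s * h (snd z))" by (simp only: mult_ac)
    also have "Re \<dots> = G (fst z) * H (snd z)"
      unfolding G_def H_def using elim by (simp only: times_complex.sel(1)[of "g (fst z) * cnj s"] mult_zero_right diff_0_right)
    finally show ?case by (simp add: fun_tensor_def split_beta)
  qed
  then show ?thesis using int le by (intro exI[of _ G] exI[of _ H] conjI)
qed

text \<open>The moduli of the terms sum to the modulus of the sum of their real parts, which forces
  every term to be real. Replacing each term by a real tensor of no larger cost gives a series whose
  total cost cannot drop below the norm, so it still attains it.\<close>

lemma norm_attaining_complex_of_real:
  assumes f: "integrable (M1 \<Otimes>\<^sub>M M2) f"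
    and rep: "tensor_series M1 M2 (\<lambda>z. complex_of_real (f z)) (L1_norm (M1 \<Otimes>\<^sub>M M2) f)"
  shows "tensor_series M1 M2 f (L1_norm (M1 \<Otimes>\<^sub>M M2) f)"
proof -
  have L: "L1_norm (M1 \<Otimes>\<^sub>M M2) (\<lambda>z. complex_of_real (f z)) = L1_norm (M1 \<Otimes>\<^sub>M M2) f"
    by (simp add: L1_norm_def)
  obtain g h where g: "\<And>i. integrable M1 (g i)" and h: "\<And>i. integrable M2 (h i)"
    and t: "(\<lambda>i. L1_norm M1 (g i) * L1_norm M2 (h i)) sums L1_norm (M1 \<Otimes>\<^sub>M M2) f"
    and ae: "AE z in M1 \<Otimes>\<^sub>M M2. (\<lambda>i. fun_tensor (g i) (h i) z) sums complex_of_real (f z)"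
    by (rule tensor_seriesE[OF rep], rule that)
  have f': "integrable (M1 \<Otimes>\<^sub>M M2) (\<lambda>z. complex_of_real (f z))" using f by simp
  have "AE z in M1 \<Otimes>\<^sub>M M2. \<forall>i. Im (fun_tensor (g i) (h i) z) = 0"
    using ae norm_attaining_tensor_series[OF f' g h t[folded L] ae]
  proof eventually_elim
    case (elim z)
    let ?v = "\<lambda>i. fun_tensor (g i) (h i) z"
    have re: "(\<lambda>i. Re (?v i)) sums f z" using sums_Re[OF elim(1)] by simp
    have norm: "(\<lambda>i. cmod (?v i)) sums \<bar>f z\<bar>" using elim(2) by simp
    have "\<forall>i. cmod (?v i) = \<bar>Re (?v i)\<bar>"
    proof (cases "0 \<le> f z")
      case True
      then have *: "(\<lambda>i. cmod (?v i) - Re (?v i)) sums 0" using sums_diff[OF norm re] by simp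
      have "\<forall>i. cmod (?v i) - Re (?v i) = 0"
        using sums_unique[OF *] complex_Re_le_cmod
        by (subst suminf_eq_zero_iff[OF sums_summable[OF *], symmetric]) auto
      then show ?thesis by (metis abs_norm_cancel right_minus_eq)
    next
      case False
      then have *: "(\<lambda>i. cmod (?v i) + Re (?v i)) sums 0" using sums_add[OF norm re] by simp
      have nn: "0 \<le> cmod (?v i) + Re (?v i)" for i using abs_Re_le_cmod[of "?v i"] by linarith
      have "\<forall>i. cmod (?v i) + Re (?v i) = 0"
        using sums_unique[OF *] nn
        by (subst suminf_eq_zero_iff[OF sums_summable[OF *], symmetric]) auto
      then show ?thesis by (metis abs_minus_cancel abs_norm_cancel add_eq_0_iff)
    qed
    then show ?case by (simp add: Im_eq_0)
  qed
  then have im: "AE z in M1 \<Otimes>\<^sub>M M2. Im (fun_tensor (g i) (h i) z) = 0" for i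
    by (simp add: AE_all_countable)
  have "\<forall>i. \<exists>g' h'. integrable M1 g' \<and> integrable M2 h' \<and>
    L1_norm M1 g' * L1_norm M2 h' \<le> L1_norm M1 (g i) * L1_norm M2 (h i) \<and>
    (AE z in M1 \<Otimes>\<^sub>M M2. fun_tensor g' h' z = Re (fun_tensor (g i) (h i) z))"
    by (intro allI real_fun_tensor g h im)
  then obtain G H where GH: "\<forall>i. integrable M1 (G i) \<and> integrable M2 (H i) \<and>
    L1_norm M1 (G i) * L1_norm M2 (H i) \<le> L1_norm M1 (g i) * L1_norm M2 (h i) \<and>
    (AE z in M1 \<Otimes>\<^sub>M M2. fun_tensor (G i) (H i) z = Re (fun_tensor (g i) (h i) z))"
    unfolding choice_iff by (elim exE)
  have "AE z in M1 \<Otimes>\<^sub>M M2. \<forall>i. fun_tensor (G i) (H i) z = Re (fun_tensor (g i) (h i) z)"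
    using GH by (simp add: AE_all_countable)
  then have ae': "AE z in M1 \<Otimes>\<^sub>M M2. (\<lambda>i. fun_tensor (G i) (H i) z) sums f z"
    using ae
  proof eventually_elim
    case (elim z)
    show ?case using sums_Re[OF elim(2)] elim(1) by simp
  qed
  have le: "L1_norm M1 (G i) * L1_norm M2 (H i) \<le> L1_norm M1 (g i) * L1_norm M2 (h i)" for i
    using GH by simp
  then have s: "summable (\<lambda>i. L1_norm M1 (G i) * L1_norm M2 (H i))"
    by (intro summable_comparison_test'[OF sums_summable[OF t], of 0]) simp
  let ?T = "\<Sum>i. L1_norm M1 (G i) * L1_norm M2 (H i)"
  have ts: "tensor_series M1 M2 f ?T"
    using GH by (intro tensor_seriesI[OF _ _ summable_sums[OF s] ae']) simp_all
  have "?T \<le> L1_norm (M1 \<Otimes>\<^sub>M M2) f"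
    using suminf_le[OF le s sums_summable[OF t]] sums_unique[OF t] by simp
  with L1_norm_le_tensor_series[OF f ts] have "?T = L1_norm (M1 \<Otimes>\<^sub>M M2) f" by (rule antisym[rotated])
  with ts show ?thesis by simp
qed

end

text \<open>The scalar field of \<open>NA_proj\<close> is the codomain type of its elements, so the
  real and the complex case of (i) are separate conjuncts; in the second, \<open>f\<close> is
  embedded to allow complex factors.\<close>

theorem corollary4p5:
  fixes M :: "'a measure" and N :: "'b measure" and f :: "'a \<times> 'b \<Rightarrow> real"
  assumes "sigma_finite_measure M" and "sigma_finite_measure N"
    and "integrable (M \<Otimes>\<^sub>M N) f"
  shows "(f \<in> NA_proj M N \<longleftrightarrow> rectangle_decomposable M N f) \<and>
    ((\<lambda>z. complex_of_real (f z)) \<in> NA_proj M N \<longleftrightarrow> rectangle_decomposable M N f) \<and>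
    (rectangle_decomposable M N f \<longleftrightarrow>
      (\<forall>c\<ge>0. ae_countable_rectangle_union M N {z \<in> space (M \<Otimes>\<^sub>M N). f z > c} \<and>
             ae_countable_rectangle_union M N {z \<in> space (M \<Otimes>\<^sub>M N). f z < - c}))"
proof (intro conjI)
  interpret pair_sigma_finite M N using assms(1,2) by (rule pair_sigma_finite.intro)
  let ?P = "M \<Otimes>\<^sub>M N" and ?F = "\<lambda>z. complex_of_real (f z)"
  have f: "integrable ?P f" and F: "integrable ?P ?F" using assms(3) by simp_all
  have L: "L1_norm ?P ?F = L1_norm ?P f" by (simp add: L1_norm_def)
  have approx: "\<exists>t. tensor_series M N f t \<and> t \<le> L1_norm ?P f + e" if "0 < e" for e
    by (rule tensor_series_le_L1_norm_add[OF f that])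
  \<comment> \<open>A real series is a complex one of the same cost, so allowing complex factors
    does not raise the infimum.\<close>
  then have approx_F: "\<exists>t. tensor_series M N ?F t \<and> t \<le> L1_norm ?P ?F + e" if "0 < e" for e
    using that tensor_series_complex_of_real unfolding L by meson
  have rep: "tensor_series M N f (L1_norm ?P f) \<longleftrightarrow> rectangle_decomposable M N f"
    unfolding rectangle_decomposable_iff[OF f]
  proof (intro iffI conjI)
    assume ts: "tensor_series M N f (L1_norm ?P f)"
    show "rect_sum M N (\<lambda>z. ennreal (f z))" by (rule norm_attaining_rect_sum[OF f ts])
    \<comment> \<open>The negative part of \<open>f\<close> is the positive part of
      \<open>- f\<close>, and negating the series preserves its cost.\<close>
    have "tensor_series M N (\<lambda>z. - f z) (L1_norm ?P (\<lambda>z. - f z))"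
      using tensor_series_uminus[OF ts] by simp
    then show "rect_sum M N (\<lambda>z. ennreal (- f z))" using f by (intro norm_attaining_rect_sum) simp_all
  qed (use rect_sums_tensor_series[OF f] in simp)
  show "f \<in> NA_proj M N \<longleftrightarrow> rectangle_decomposable M N f"
    using NA_proj_iff_tensor_series[OF f approx] rep by simp
  have NA_F: "?F \<in> NA_proj M N \<longleftrightarrow> tensor_series M N ?F (L1_norm ?P f)"
    using NA_proj_iff_tensor_series[OF F approx_F] by (simp only: L)
  show "?F \<in> NA_proj M N \<longleftrightarrow> rectangle_decomposable M N f"
    unfolding NA_F rep[symmetric]
    by (rule iffI[OF norm_attaining_complex_of_real[OF f] tensor_series_complex_of_real])
  show "rectangle_decomposable M N f \<longleftrightarrow>
      (\<forall>c\<ge>0. ae_countable_rectangle_union M N {z \<in> space ?P. f z > c} \<and>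
             ae_countable_rectangle_union M N {z \<in> space ?P. f z < - c})"
    by (rule rectangle_decomposable_iff_superlevel[OF f])
qed

end
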